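(* Let $K$ be a field and let $H=(H^0,H^1,s,r)$ be a hypergraph such that $|s(h)|\geq 2$ and $|r(h)|\geq 2$ for any $h\in H^1$. Then the Leavitt path algebra $L_K(H)$ is nonsingular.
   Context: Algebras are associative but not necessarily unital. A multiset over a set $Y$ is a function $M:Y\to\mathbb N_0$; its support is $M_{\mathrm{supp}}=\{y\in Y\mid M(y)>0\}$. $\mathrm{Mult}(Y)$ is the set of multisets over $Y$ with finite, nonempty support, and $|M|=\sum_{y\in M_{\mathrm{supp}}}M(y)$. A (directed) hypergraph is a quadruple $H=(H^0,H^1,s,r)$ where $H^0,H^1$ are sets and $s,r:H^1\to\mathrm{Mult}(H^0)$ are maps. All hypergraphs are assumed nonempty (not $H^0=H^1=\emptyset$). For each $h\in H^1$ fix listings with multiplicity $s(h)=\{s(h)_1,\dots,s(h)_{|s(h)|}\}$ and $r(h)=\{r(h)_1,\dots,r(h)_{|r(h)|}\}$. The Leavitt path algebra $L_K(H)$ is the (not necessarily unital) $K$-algebra presented by the generators $v,h_{ij},h_{ij}^*$ ($v\in H^0$, $h\in H^1$, $1\le i\le|s(h)|$, $1\le j\le|r(h)|$) and the relations: (i) $uv=\delta_{uv}u$ ($u,v\in H^0$); (ii) $s(h)_ih_{ij}=h_{ij}=h_{ij}r(h)_j$ and $r(h)_jh_{ij}^*=h_{ij}^*=h_{ij}^*s(h)_i$ for all $h,i,j$; (iii) $\sum_{k=1}^{|r(h)|}h_{ik}h_{jk}^*=\delta_{ij}s(h)_i$ ($h\in H^1$, $1\le i,j\le|s(h)|$); (iv)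 $\sum_{k=1}^{|s(h)|}h_{ki}^*h_{kj}=\delta_{ij}r(h)_i$ ($h\in H^1$, $1\le i,j\le|r(h)|$). A left ideal $I$ of a ring $R$ is essential if $I\cap J=\{0\}$ implies $J=\{0\}$ for any left ideal $J$ of $R$. $R$ is left nonsingular if for every $x\in R$, the left ideal $\{y\in R\mid yx=0\}$ is essential iff $x=0$; right nonsingular is defined symmetrically; nonsingular means left and right nonsingular. *)

theory Defs
  imports "HOL-Library.Multiset" "HOL-Library.Poly_Mapping" "HOL-Algebra.QuotRing"
begin

section \<open>Hypergraphs\<close>

definition Mult :: "'v set \<Rightarrow> 'v multiset set" where
  "Mult Y = {M. M \<noteq> {#} \<and> set_mset M \<subseteq> Y}"

text \<open>The values of the source and range maps outside the set of hyperedges carry no meaning.\<close>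

record ('v, 'e) hypergraph =
  hverts :: "'v set"
  hedges :: "'e set"
  hsrc :: "'e \<Rightarrow> 'v multiset"
  hrng :: "'e \<Rightarrow> 'v multiset"

definition is_hypergraph :: "('v, 'e) hypergraph \<Rightarrow> bool" where
  "is_hypergraph H \<longleftrightarrow>
     hsrc H \<in> hedges H \<rightarrow> Mult (hverts H) \<and>
     hrng H \<in> hedges H \<rightarrow> Mult (hverts H) \<and>
     \<not> (hverts H = {} \<and> hedges H = {})"

text \<open>A listing with multiplicity of \<open>s h\<close> for every hyperedge \<open>h\<close>. The entries of
  the list \<open>l h\<close> are numbered from 0, so all indices below are shifted by one compared with
  the usual numbering from 1.\<close>

definition is_listing :: "'e set \<Rightarrow> ('e \<Rightarrow> 'v multiset) \<Rightarrow> ('e \<Rightarrow> 'v list) \<Rightarrow> bool" where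
  "is_listing E s l \<longleftrightarrow> (\<forall>h\<in>E. mset (l h) = s h)"

section \<open>Non-unital algebras presented by generators and relations\<close>

text \<open>Concatenation of words is written additively because multiplication of finitely supported
  functions is convolution with respect to \<open>+\<close> on their domain. Thus \<open>'g word \<Rightarrow>\<^sub>0 'k\<close> is the
  free unital algebra on the type \<open>'g\<close>.\<close>

datatype 'g word = Word (letters: "'g list")

instantiation word :: (type) monoid_add
begin

definition zero_word :: "'a word" where
  "0 = Word []"

definition plus_word :: "'a word \<Rightarrow> 'a word \<Rightarrow> 'a word" where
  "u + v = Word (letters u @ letters v)"

instance
  by standard (simp_all add: zero_word_def plus_word_def)

end

definition gen :: "'g \<Rightarrow> ('g word \<Rightarrow>\<^sub>0 'k::field)" where
  "gen g = Poly_Mapping.single (Word [g]) 1"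

definition scale :: "'k::field \<Rightarrow> ('g word \<Rightarrow>\<^sub>0 'k) \<Rightarrow> ('g word \<Rightarrow>\<^sub>0 'k)" where
  "scale c f = Poly_Mapping.map (\<lambda>x. c * x) f"

text \<open>The free non-unital algebra on \<open>X\<close>: linear combinations of nonempty words over \<open>X\<close>.
  The field \<open>one\<close> of the record is a dummy; it only enters the equally
  meaningless \<open>one\<close> of a quotient.\<close>

definition free_algebra :: "'g set \<Rightarrow> ('g word \<Rightarrow>\<^sub>0 'k::field) ring" where
  "free_algebra X =
     \<lparr>carrier = {f. \<forall>w\<in>Poly_Mapping.keys f. letters w \<noteq> [] \<and> set (letters w) \<subseteq> X},
      mult = (*), one = undefined, zero = 0, add = (+)\<rparr>"

inductive_set ideal_generated :: "'g set \<Rightarrow> ('g word \<Rightarrow>\<^sub>0 'k::field) set \<Rightarrow> ('g word \<Rightarrow>\<^sub>0 'k) set"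
  for X :: "'g set" and S :: "('g word \<Rightarrow>\<^sub>0 'k::field) set"
where
  zero: "0 \<in> ideal_generated X S"
| base: "a \<in> S \<Longrightarrow> a \<in> ideal_generated X S"
| add: "a \<in> ideal_generated X S \<Longrightarrow> b \<in> ideal_generated X S \<Longrightarrow> a + b \<in> ideal_generated X S"
| scale: "a \<in> ideal_generated X S \<Longrightarrow> scale c a \<in> ideal_generated X S"
| left: "a \<in> ideal_generated X S \<Longrightarrow> f \<in> carrier (free_algebra X) \<Longrightarrow> f * a \<in> ideal_generated X S"
| right: "a \<in> ideal_generated X S \<Longrightarrow> f \<in> carrier (free_algebra X) \<Longrightarrow> a * f \<in> ideal_generated X S"

definition presented_algebra ::
  "'g set \<Rightarrow> ('g word \<Rightarrow>\<^sub>0 'k::field) set \<Rightarrow> ('g word \<Rightarrow>\<^sub>0 'k) set ring" where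
  "presented_algebra X S = free_algebra X Quot ideal_generated X S"

section \<open>The Leavitt path algebra of a hypergraph\<close>

text \<open>\<open>Ghost h i j\<close> stands for the starred generator belonging to \<open>Edge h i j\<close>; its first index too
  refers to the source and its second to the range.\<close>

datatype ('v, 'e) lpa_gen = Vertex 'v | Edge 'e nat nat | Ghost 'e nat nat

definition lpa_gens :: "('v, 'e) hypergraph \<Rightarrow> ('v, 'e) lpa_gen set" where
  "lpa_gens H =
     {Vertex v |v. v \<in> hverts H} \<union>
     {Edge h i j |h i j. h \<in> hedges H \<and> i < size (hsrc H h) \<and> j < size (hrng H h)} \<union>
     {Ghost h i j |h i j. h \<in> hedges H \<and> i < size (hsrc H h) \<and> j < size (hrng H h)}"

text \<open>An equation \<open>p = q\<close> is represented by the element \<open>p - q\<close>; \<open>sl\<close> and \<open>rl\<close> are listings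
  of the sources and ranges.\<close>

definition lpa_rels ::
  "('v, 'e) hypergraph \<Rightarrow> ('e \<Rightarrow> 'v list) \<Rightarrow> ('e \<Rightarrow> 'v list) \<Rightarrow>
     (('v, 'e) lpa_gen word \<Rightarrow>\<^sub>0 'k::field) set" where
  "lpa_rels H sl rl =
     {gen (Vertex u) * gen (Vertex v) - (if u = v then gen (Vertex u) else 0) |u v.
        u \<in> hverts H \<and> v \<in> hverts H} \<union>
     {gen (Vertex (sl h ! i)) * gen (Edge h i j) - gen (Edge h i j) |h i j.
        h \<in> hedges H \<and> i < size (hsrc H h) \<and> j < size (hrng H h)} \<union>
     {gen (Edge h i j) * gen (Vertex (rl h ! j)) - gen (Edge h i j) |h i j.
        h \<in> hedges H \<and> i < size (hsrc H h) \<and> j < size (hrng H h)} \<union>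
     {gen (Vertex (rl h ! j)) * gen (Ghost h i j) - gen (Ghost h i j) |h i j.
        h \<in> hedges H \<and> i < size (hsrc H h) \<and> j < size (hrng H h)} \<union>
     {gen (Ghost h i j) * gen (Vertex (sl h ! i)) - gen (Ghost h i j) |h i j.
        h \<in> hedges H \<and> i < size (hsrc H h) \<and> j < size (hrng H h)} \<union>
     {(\<Sum>k<size (hrng H h). gen (Edge h i k) * gen (Ghost h j k))
        - (if i = j then gen (Vertex (sl h ! i)) else 0) |h i j.
        h \<in> hedges H \<and> i < size (hsrc H h) \<and> j < size (hsrc H h)} \<union>
     {(\<Sum>k<size (hsrc H h). gen (Ghost h k i) * gen (Edge h k j))
        - (if i = j then gen (Vertex (rl h ! i)) else 0) |h i j.
        h \<in> hedges H \<and> i < size (hrng H h) \<and> j < size (hrng H h)}"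

definition leavitt_path_algebra ::
  "'k::field itself \<Rightarrow> ('v, 'e) hypergraph \<Rightarrow> ('e \<Rightarrow> 'v list) \<Rightarrow> ('e \<Rightarrow> 'v list) \<Rightarrow>
     (('v, 'e) lpa_gen word \<Rightarrow>\<^sub>0 'k) set ring" where
  "leavitt_path_algebra _ H sl rl = presented_algebra (lpa_gens H) (lpa_rels H sl rl)"

section \<open>Nonsingular rings\<close>

text \<open>The ideals of the library presuppose a unital ring, hence the definitions below, which use
  only the additive group and the multiplication of \<open>R\<close>.\<close>

definition left_ideal :: "'a set \<Rightarrow> ('a, 'm) ring_scheme \<Rightarrow> bool" where
  "left_ideal I R \<longleftrightarrow>
     additive_subgroup I R \<and> (\<forall>x\<in>carrier R. \<forall>a\<in>I. x \<otimes>\<^bsub>R\<^esub> a \<in> I)"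

definition right_ideal :: "'a set \<Rightarrow> ('a, 'm) ring_scheme \<Rightarrow> bool" where
  "right_ideal I R \<longleftrightarrow>
     additive_subgroup I R \<and> (\<forall>x\<in>carrier R. \<forall>a\<in>I. a \<otimes>\<^bsub>R\<^esub> x \<in> I)"

definition essential_left_ideal :: "'a set \<Rightarrow> ('a, 'm) ring_scheme \<Rightarrow> bool" where
  "essential_left_ideal I R \<longleftrightarrow>
     left_ideal I R \<and> (\<forall>J. left_ideal J R \<and> I \<inter> J = {\<zero>\<^bsub>R\<^esub>} \<longrightarrow> J = {\<zero>\<^bsub>R\<^esub>})"

definition essential_right_ideal :: "'a set \<Rightarrow> ('a, 'm) ring_scheme \<Rightarrow> bool" where
  "essential_right_ideal I R \<longleftrightarrow>
     right_ideal I R \<and> (\<forall>J. right_ideal J R \<and> I \<inter> J = {\<zero>\<^bsub>R\<^esub>} \<longrightarrow> J = {\<zero>\<^bsub>R\<^esub>})"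

definition left_nonsingular :: "('a, 'm) ring_scheme \<Rightarrow> bool" where
  "left_nonsingular R \<longleftrightarrow>
     (\<forall>x\<in>carrier R. essential_left_ideal {y \<in> carrier R. y \<otimes>\<^bsub>R\<^esub> x = \<zero>\<^bsub>R\<^esub>} R \<longleftrightarrow> x = \<zero>\<^bsub>R\<^esub>)"

definition right_nonsingular :: "('a, 'm) ring_scheme \<Rightarrow> bool" where
  "right_nonsingular R \<longleftrightarrow>
     (\<forall>x\<in>carrier R. essential_right_ideal {y \<in> carrier R. x \<otimes>\<^bsub>R\<^esub> y = \<zero>\<^bsub>R\<^esub>} R \<longleftrightarrow> x = \<zero>\<^bsub>R\<^esub>)"

definition nonsingular :: "('a, 'm) ring_scheme \<Rightarrow> bool" where
  "nonsingular R \<longleftrightarrow> left_nonsingular R \<and> right_nonsingular R"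

end

theory Submission
  imports Defs
begin

text \<open>Rewriting the first summand in each of the relations (iii) and (iv) gives a confluent system, so the algebra has a basis of normal words, here obtained from a right action on
  their span. Counting non-vertex letters filters the algebra. Since all \<open>|s(h)|\<close> and \<open>|r(h)|\<close> are at
  least 2, leading terms show that \<open>x v \<noteq> 0\<close> and \<open>v y \<noteq> 0\<close> imply \<open>x v y \<noteq> 0\<close> for every vertex \<open>v\<close>.
  Given \<open>x \<noteq> 0\<close>, choose \<open>v\<close> with \<open>v x \<noteq> 0\<close>: the left ideal generated by \<open>v\<close> then meets the left
  annihilator of \<open>x\<close> only in 0. The right-hand version is symmetric.\<close>

section \<open>Quotients of the free algebra\<close>

text \<open>The obstacle is the independence of normal words modulo the ideal. No diamond lemma is
  invoked: a product of a normal word with one generator is prescribed, every relation is checked to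
  act as zero, and so the image of the unit under an element depends only on its coset. The one
  delicate overlap is \<open>arrow (flip e) p 0 * arrow e 0 0 * arrow (flip e) 0 j\<close>;
  exchanging two finite sums settles it. Leading words do not multiply to a single word: where a
  cancelling pair meets, a sum of words of top length appears besides a possible shorter one, and
  different pairs may yield the same word. Hence the search for one top word with a unique origin.
  The bound 2 is what makes the product property plausible: for \<open>|s(h)| = 1\<close> and
  \<open>|r(h)| \<ge> 2\<close>, relation (iv) reads \<open>h_{11}^* h_{12} = 0\<close> although the
  two factors meet at the vertex \<open>s(h)_1\<close>.\<close>

lemma plus_Word [simp]: "Word u + Word v = Word (u @ v)"
  by (simp add: plus_word_def)

lemma scale_conv_mult: "scale c f = Poly_Mapping.single 0 c * f"
  unfolding scale_def by (rule mult_map_scale_conv_mult)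

lemma lookup_scale [simp]: "Poly_Mapping.lookup (scale c f) w = c * Poly_Mapping.lookup f w"
  unfolding scale_def by (simp add: Poly_Mapping.map.rep_eq when_def)

lemma scale_single [simp]: "scale c (Poly_Mapping.single w d) = Poly_Mapping.single w (c * d)"
  by (simp add: scale_conv_mult mult_single)

lemma scale_add_right: "scale c (f + g) = scale c f + scale c g"
  by (simp add: scale_conv_mult distrib_left)

lemma scale_diff_right: "scale c (f - g) = scale c f - scale c g"
  by (simp add: scale_conv_mult right_diff_distrib)

lemma scale_add_left: "scale (c + d) f = scale c f + scale d f"
  by (simp add: scale_conv_mult single_add distrib_right)

lemma scale_zero_left [simp]: "scale 0 f = 0"
  by (simp add: scale_conv_mult)

lemma scale_zero_right [simp]: "scale c 0 = 0"
  by (simp add: scale_conv_mult)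

lemma scale_one [simp]: "scale 1 f = f"
  by (simp add: scale_conv_mult)

lemma scale_scale [simp]: "scale c (scale d f) = scale (c * d) f"
  by (simp add: scale_conv_mult mult.assoc [symmetric] mult_single)

lemma scale_minus_one: "scale (- 1) f = - f"
  by (simp add: scale_conv_mult single_uminus)

lemma scale_sum: "scale c (\<Sum>i\<in>A. f i) = (\<Sum>i\<in>A. scale c (f i))"
  by (simp add: scale_conv_mult sum_distrib_left)

lemma mult_scale_left: "scale c f * g = scale c (f * g)"
  by (simp add: scale_conv_mult mult.assoc)

lemma poly_mapping_sum_single:
  fixes f :: "'a \<Rightarrow>\<^sub>0 'b::comm_monoid_add"
  shows "f = (\<Sum>w\<in>Poly_Mapping.keys f. Poly_Mapping.single w (Poly_Mapping.lookup f w))"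
  by (rule poly_mapping_eqI)
    (simp add: lookup_sum lookup_single when_def sum.delta' in_keys_iff cong: if_cong)

lemma poly_mapping_linear_induct [consumes 1, case_names zero single add]:
  fixes f :: "'a \<Rightarrow>\<^sub>0 'b::comm_monoid_add"
  assumes "Poly_Mapping.keys f \<subseteq> S"
    and "P 0"
    and "\<And>w c. w \<in> S \<Longrightarrow> P (Poly_Mapping.single w c)"
    and "\<And>f g. P f \<Longrightarrow> P g \<Longrightarrow> P (f + g)"
  shows "P f"
proof -
  have "P (\<Sum>w\<in>A. Poly_Mapping.single w (Poly_Mapping.lookup f w))" if "finite A" "A \<subseteq> S" for A
    using that by (induction A) (auto intro: assms)
  from this [OF _ assms(1)] show ?thesis
    by (simp add: poly_mapping_sum_single [of f, symmetric])
qed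

text \<open>Scalars are supported on the empty word, which is neutral for concatenation, so they are
  central even though words do not commute.\<close>

lemma mult_scale_right: "f * scale c g = scale c (f * g)"
proof -
  have "f * Poly_Mapping.single 0 c = Poly_Mapping.single 0 c * f"
    by (induction f rule: poly_mapping_linear_induct [OF subset_UNIV])
      (simp_all add: mult_single mult.commute distrib_left distrib_right)
  then show ?thesis
    by (simp add: scale_conv_mult mult.assoc [symmetric])
qed

section \<open>Linear extension of maps given on words\<close>

definition linear_extension ::
  "('g word \<Rightarrow> ('h word \<Rightarrow>\<^sub>0 'k::field)) \<Rightarrow> ('g word \<Rightarrow>\<^sub>0 'k) \<Rightarrow> ('h word \<Rightarrow>\<^sub>0 'k)" where
  "linear_extension \<phi> f = (\<Sum>w\<in>Poly_Mapping.keys f. scale (Poly_Mapping.lookup f w) (\<phi> w))"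

lemma linear_extension_zero [simp]: "linear_extension \<phi> 0 = 0"
  by (simp add: linear_extension_def)

lemma linear_extension_single [simp]:
  "linear_extension \<phi> (Poly_Mapping.single w c) = scale c (\<phi> w)"
  by (simp add: linear_extension_def)

lemma linear_extension_superset:
  assumes "finite A" "Poly_Mapping.keys f \<subseteq> A"
  shows "linear_extension \<phi> f = (\<Sum>w\<in>A. scale (Poly_Mapping.lookup f w) (\<phi> w))"
  unfolding linear_extension_def
  by (rule sum.mono_neutral_left) (use assms in \<open>auto simp: in_keys_iff\<close>)

lemma linear_extension_add:
  "linear_extension \<phi> (f + g) = linear_extension \<phi> f + linear_extension \<phi> g"
  using keys_add [of f g]
  by (simp add: linear_extension_superset [where A = "Poly_Mapping.keys f \<union> Poly_Mapping.keys g"]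
      lookup_add scale_add_left sum.distrib)

lemma linear_extension_scale:
  "linear_extension \<phi> (scale c f) = scale c (linear_extension \<phi> f)"
  by (subst (1 2) linear_extension_superset [where A = "Poly_Mapping.keys f"])
    (auto simp: in_keys_iff scale_sum)

lemma linear_extension_diff:
  "linear_extension \<phi> (f - g) = linear_extension \<phi> f - linear_extension \<phi> g"
  using linear_extension_add [of \<phi> f "scale (- 1) g"] linear_extension_scale [of \<phi> "- 1" g]
  by (simp add: scale_minus_one)

lemma linear_extension_sum:
  "linear_extension \<phi> (\<Sum>i\<in>A. f i) = (\<Sum>i\<in>A. linear_extension \<phi> (f i))"
  by (induction A rule: infinite_finite_induct) (simp_all add: linear_extension_add)

lemma keys_linear_extension:
  "Poly_Mapping.keys (linear_extension \<phi> f) \<subseteq> (\<Union>w\<in>Poly_Mapping.keys f. Poly_Mapping.keys (\<phi> w))"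
proof
  fix v assume "v \<in> Poly_Mapping.keys (linear_extension \<phi> f)"
  then have "(\<Sum>w\<in>Poly_Mapping.keys f. Poly_Mapping.lookup f w * Poly_Mapping.lookup (\<phi> w) v) \<noteq> 0"
    by (simp add: linear_extension_def in_keys_iff lookup_sum)
  then obtain w where "w \<in> Poly_Mapping.keys f"
      "Poly_Mapping.lookup f w * Poly_Mapping.lookup (\<phi> w) v \<noteq> 0"
    by (rule sum.not_neutral_contains_not_neutral)
  then show "v \<in> (\<Union>w\<in>Poly_Mapping.keys f. Poly_Mapping.keys (\<phi> w))"
    by (auto simp: in_keys_iff)
qed

lemma linear_extension_cong:
  "(\<And>w. w \<in> Poly_Mapping.keys f \<Longrightarrow> \<phi> w = \<psi> w) \<Longrightarrow> linear_extension \<phi> f = linear_extension \<psi> f"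
  by (simp add: linear_extension_def)

lemma lookup_linear_extension:
  "Poly_Mapping.lookup (linear_extension \<phi> f) z =
    (\<Sum>w\<in>Poly_Mapping.keys f. Poly_Mapping.lookup f w * Poly_Mapping.lookup (\<phi> w) z)"
  by (simp add: linear_extension_def lookup_sum)

text \<open>Multiplication by a vertex will be such a projection on normal words; the coefficient of
  a selected word survives it.\<close>

lemma lookup_linear_extension_select:
  "Poly_Mapping.lookup (linear_extension (\<lambda>w. if P w then Poly_Mapping.single w 1 else 0) f) z =
    (if P z then Poly_Mapping.lookup f z else 0)"
proof -
  have "Poly_Mapping.lookup f w * Poly_Mapping.lookup (if P w then Poly_Mapping.single w 1 else 0) z =
      (if w = z then if P z then Poly_Mapping.lookup f z else 0 else 0)" for w
    by (simp add: lookup_single when_def)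
  then show ?thesis
    by (simp add: lookup_linear_extension in_keys_iff)
qed

section \<open>The non-unital free algebra and its ideals\<close>

lemma carrier_free_algebra_iff:
  "f \<in> carrier (free_algebra X) \<longleftrightarrow>
     (\<forall>w\<in>Poly_Mapping.keys f. letters w \<noteq> [] \<and> set (letters w) \<subseteq> X)"
  by (simp add: free_algebra_def)

lemma free_algebra_ops [simp]:
  "mult (free_algebra X) = (*)" "add (free_algebra X) = (+)" "zero (free_algebra X) = 0"
  by (simp_all add: free_algebra_def)

lemma free_algebra_zero: "0 \<in> carrier (free_algebra X)"
  by (simp add: carrier_free_algebra_iff)

lemma free_algebra_add:
  "f \<in> carrier (free_algebra X) \<Longrightarrow> g \<in> carrier (free_algebra X) \<Longrightarrow>
    f + g \<in> carrier (free_algebra X)"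
  using keys_add [of f g] by (auto simp: carrier_free_algebra_iff)

lemma free_algebra_scale:
  "f \<in> carrier (free_algebra X) \<Longrightarrow> scale c f \<in> carrier (free_algebra X)"
  by (auto simp: carrier_free_algebra_iff in_keys_iff)

lemma free_algebra_diff:
  "f \<in> carrier (free_algebra X) \<Longrightarrow> g \<in> carrier (free_algebra X) \<Longrightarrow>
    f - g \<in> carrier (free_algebra X)"
  using free_algebra_add [OF _ free_algebra_scale, of f X g "- 1"] by (simp add: scale_minus_one)

lemma free_algebra_uminus:
  "f \<in> carrier (free_algebra X) \<Longrightarrow> - f \<in> carrier (free_algebra X)"
  using free_algebra_diff [OF free_algebra_zero] by fastforce

lemma free_algebra_mult:
  assumes "f \<in> carrier (free_algebra X)" "g \<in> carrier (free_algebra X)"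
  shows "f * g \<in> carrier (free_algebra X)"
  using keys_mult [of f g] assms
  by (fastforce simp: carrier_free_algebra_iff plus_word_def)

lemma free_algebra_sum:
  "(\<And>i. i \<in> A \<Longrightarrow> f i \<in> carrier (free_algebra X)) \<Longrightarrow>
    (\<Sum>i\<in>A. f i) \<in> carrier (free_algebra X)"
  by (induction A rule: infinite_finite_induct)
    (simp_all add: free_algebra_zero free_algebra_add)

lemma free_algebra_gen: "g \<in> X \<Longrightarrow> gen g \<in> carrier (free_algebra X)"
  by (simp add: carrier_free_algebra_iff gen_def)

lemmas free_algebra_closed =
  free_algebra_zero free_algebra_add free_algebra_scale free_algebra_diff free_algebra_uminus
  free_algebra_mult free_algebra_sum free_algebra_gen

lemma ideal_generated_subset:
  assumes "S \<subseteq> carrier (free_algebra X)" "a \<in> ideal_generated X S"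
  shows "a \<in> carrier (free_algebra X)"
  using assms(2,1) by induction (auto intro: free_algebra_closed)

lemma ideal_generated_uminus:
  "a \<in> ideal_generated X S \<Longrightarrow> - a \<in> ideal_generated X S"
  using ideal_generated.scale [of a X S "- 1"] by (simp add: scale_minus_one)

lemma ideal_generated_diff:
  "a \<in> ideal_generated X S \<Longrightarrow> b \<in> ideal_generated X S \<Longrightarrow> a - b \<in> ideal_generated X S"
  using ideal_generated.add [OF _ ideal_generated_uminus, of a X S b] by simp

section \<open>Cosets and the quotient ring\<close>

definition coset :: "'g set \<Rightarrow> ('g word \<Rightarrow>\<^sub>0 'k::field) set \<Rightarrow> ('g word \<Rightarrow>\<^sub>0 'k) \<Rightarrow> ('g word \<Rightarrow>\<^sub>0 'k) set" where
  "coset X S f = {a. a - f \<in> ideal_generated X S}"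

lemma coset_eq_iff: "coset X S f = coset X S g \<longleftrightarrow> f - g \<in> ideal_generated X S"
proof
  assume "coset X S f = coset X S g"
  moreover have "f \<in> coset X S f"
    by (simp add: coset_def ideal_generated.zero)
  ultimately show "f - g \<in> ideal_generated X S"
    by (auto simp: coset_def)
next
  assume *: "f - g \<in> ideal_generated X S"
  have "a - f \<in> ideal_generated X S \<longleftrightarrow> a - g \<in> ideal_generated X S" for a
    using ideal_generated.add [OF _ *, of "a - f"] ideal_generated_diff [OF _ *, of "a - g"]
    by auto
  then show "coset X S f = coset X S g"
    by (simp add: coset_def)
qed

lemma a_r_coset_free_algebra:
  "ideal_generated X S +>\<^bsub>free_algebra X\<^esub> f = coset X S f"
proof -
  have "ideal_generated X S +>\<^bsub>free_algebra X\<^esub> f = {a + f |a. a \<in> ideal_generated X S}"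
    by (auto simp: a_r_coset_def r_coset_def)
  also have "\<dots> = coset X S f"
    by (auto simp: coset_def intro: exI [of _ "_ - f"])
  finally show ?thesis .
qed

lemma carrier_presented_algebra:
  "carrier (presented_algebra X S) = coset X S ` carrier (free_algebra X)"
proof -
  have "a_rcosets\<^bsub>free_algebra X\<^esub> (ideal_generated X S) =
      (\<lambda>f. ideal_generated X S +>\<^bsub>free_algebra X\<^esub> f) ` carrier (free_algebra X)"
    by (auto simp: A_RCOSETS_def RCOSETS_def a_r_coset_def)
  then show ?thesis
    by (simp add: presented_algebra_def FactRing_def a_r_coset_free_algebra)
qed

lemma zero_presented_algebra: "\<zero>\<^bsub>presented_algebra X S\<^esub> = coset X S 0"
  by (simp add: presented_algebra_def FactRing_def coset_def)

lemma add_presented_algebra: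
  "coset X S f \<oplus>\<^bsub>presented_algebra X S\<^esub> coset X S g = coset X S (f + g)"
proof -
  have "\<exists>a\<in>coset X S f. \<exists>b\<in>coset X S g. x = a + b" if "x - (f + g) \<in> ideal_generated X S" for x
    by (rule bexI [of _ "x - g"], rule bexI [of _ g])
      (use that in \<open>auto simp: coset_def ideal_generated.zero algebra_simps\<close>)
  moreover have "a + b - (f + g) \<in> ideal_generated X S"
    if "a - f \<in> ideal_generated X S" "b - g \<in> ideal_generated X S" for a b
    using ideal_generated.add [OF that] by (simp add: algebra_simps)
  ultimately show ?thesis
    by (fastforce simp: presented_algebra_def FactRing_def set_add_def set_mult_def coset_def)
qed

text \<open>The quotient product is a union over all representatives \<open>a\<close>,
  \<open>b\<close>, and \<open>a b - f g = a (b - g) + (a - f) g\<close>. The ideal absorbs only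
  factors from the free algebra, so \<open>a\<close> must lie there; this is where \<open>S\<close>
  being a subset of it enters.\<close>

lemma mult_presented_algebra:
  assumes S: "S \<subseteq> carrier (free_algebra X)"
    and f: "f \<in> carrier (free_algebra X)" and g: "g \<in> carrier (free_algebra X)"
  shows "coset X S f \<otimes>\<^bsub>presented_algebra X S\<^esub> coset X S g = coset X S (f * g)"
proof -
  have "coset X S (a * b) = coset X S (f * g)"
    if a: "a \<in> coset X S f" and b: "b \<in> coset X S g" for a b
  proof -
    have a': "a \<in> carrier (free_algebra X)"
      using free_algebra_add [OF ideal_generated_subset [OF S] f, of "a - f"] a
      by (simp add: coset_def)
    have "a * (b - g) + (a - f) * g \<in> ideal_generated X S"
      using a b a' g by (auto simp: coset_def intro: ideal_generated.intros)
    then show ?thesis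
      by (simp add: coset_eq_iff algebra_simps)
  qed
  moreover have "f \<in> coset X S f" "g \<in> coset X S g"
    by (simp_all add: coset_def ideal_generated.zero)
  ultimately have "(\<Union>a\<in>coset X S f. \<Union>b\<in>coset X S g. coset X S (a * b)) = coset X S (f * g)"
    by blast
  then show ?thesis
    by (simp add: presented_algebra_def FactRing_def rcoset_mult_def a_r_coset_free_algebra)
qed

lemma group_presented_algebra: "group (add_monoid (presented_algebra X S))"
proof (rule groupI)
  fix x assume "x \<in> carrier (add_monoid (presented_algebra X S))"
  then obtain f where f: "f \<in> carrier (free_algebra X)" "x = coset X S f"
    by (auto simp: carrier_presented_algebra)
  show "\<exists>y\<in>carrier (add_monoid (presented_algebra X S)).
      y \<otimes>\<^bsub>add_monoid (presented_algebra X S)\<^esub> x = \<one>\<^bsub>add_monoid (presented_algebra X S)\<^esub>"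
    by (rule bexI [of _ "coset X S (- f)"])
      (use f in \<open>auto simp: carrier_presented_algebra add_presented_algebra zero_presented_algebra
        intro: free_algebra_closed\<close>)
qed (auto simp: carrier_presented_algebra add_presented_algebra zero_presented_algebra add.assoc
    intro: free_algebra_closed)

text \<open>Serves the whole quotient as well as the one-sided ideals \<open>F u\<close> and
  \<open>u F\<close> below.\<close>

lemma additive_subgroup_presented_algebra:
  assumes A: "A \<subseteq> carrier (free_algebra X)" and "0 \<in> A"
    and add: "\<And>f g. f \<in> A \<Longrightarrow> g \<in> A \<Longrightarrow> f + g \<in> A" and uminus: "\<And>f. f \<in> A \<Longrightarrow> - f \<in> A"
  shows "additive_subgroup (coset X S ` A) (presented_algebra X S)"
proof (rule additive_subgroup.intro, rule group.subgroupI [OF group_presented_algebra])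
  fix x assume "x \<in> coset X S ` A"
  then obtain f where f: "f \<in> A" "x = coset X S f"
    by blast
  have "inv\<^bsub>add_monoid (presented_algebra X S)\<^esub> x = coset X S (- f)"
    by (rule group.inv_equality [OF group_presented_algebra])
      (use f A uminus in \<open>auto simp: carrier_presented_algebra add_presented_algebra
        zero_presented_algebra\<close>)
  then show "inv\<^bsub>add_monoid (presented_algebra X S)\<^esub> x \<in> coset X S ` A"
    using f uminus by auto
qed (use assms in \<open>auto simp: carrier_presented_algebra add_presented_algebra\<close>)

text \<open>The elements of \<open>U\<close> play the role of local units.\<close>

lemma nonsingular_presented_algebra:
  assumes S: "S \<subseteq> carrier (free_algebra X)" and U: "U \<subseteq> carrier (free_algebra X)"
    and idem: "\<And>u. u \<in> U \<Longrightarrow> u * u - u \<in> ideal_generated X S"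
    and left_unit: "\<And>x. x \<in> carrier (free_algebra X) \<Longrightarrow> x \<notin> ideal_generated X S \<Longrightarrow>
      \<exists>u\<in>U. u * x \<notin> ideal_generated X S"
    and right_unit: "\<And>x. x \<in> carrier (free_algebra X) \<Longrightarrow> x \<notin> ideal_generated X S \<Longrightarrow>
      \<exists>u\<in>U. x * u \<notin> ideal_generated X S"
    and local_domain: "\<And>x y u. x \<in> carrier (free_algebra X) \<Longrightarrow> y \<in> carrier (free_algebra X) \<Longrightarrow>
      u \<in> U \<Longrightarrow> x * u * y \<in> ideal_generated X S \<Longrightarrow>
      x * u \<in> ideal_generated X S \<or> u * y \<in> ideal_generated X S"
  shows "nonsingular (presented_algebra X S)"
proof -
  let ?R = "presented_algebra X S" and ?F = "carrier (free_algebra X)"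
    and ?I = "ideal_generated X S" and ?q = "coset X S"
  note simps = carrier_presented_algebra zero_presented_algebra mult_presented_algebra [OF S]
    coset_eq_iff
  have all: "additive_subgroup (carrier ?R) ?R"
    unfolding carrier_presented_algebra
    by (rule additive_subgroup_presented_algebra) (auto intro: free_algebra_closed)
  have carrier_J: "J \<subseteq> carrier ?R" if "additive_subgroup J ?R" for J
    using additive_subgroup.a_subset [OF that] .
  have zero: "0 \<in> ?I"
    by (rule ideal_generated.zero)
  \<comment> \<open>If \<open>u\<close> were in the ideal, so would be \<open>u * x\<close> and
    \<open>x * u\<close>; and \<open>u * u\<close> differs from \<open>u\<close> by an element of
    the ideal.\<close>
  have nz: "?q (u * u) \<noteq> ?q 0" if "u \<in> U" "u * x \<notin> ?I \<or> x * u \<notin> ?I" "x \<in> ?F" for u x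
  proof -
    have "u \<notin> ?I"
      using that ideal_generated.left [of u X S x] ideal_generated.right [of u X S x] by blast
    then show "?q (u * u) \<noteq> ?q 0"
      using ideal_generated_diff [of "u * u" X S "u * u - u"] idem [OF \<open>u \<in> U\<close>] \<open>u \<notin> ?I\<close>
      by (auto simp: coset_eq_iff)
  qed
  have mult_zero: "a \<otimes>\<^bsub>?R\<^esub> \<zero>\<^bsub>?R\<^esub> = \<zero>\<^bsub>?R\<^esub>" "\<zero>\<^bsub>?R\<^esub> \<otimes>\<^bsub>?R\<^esub> a = \<zero>\<^bsub>?R\<^esub>" if "a \<in> carrier ?R" for a
    using that by (auto simp: simps free_algebra_zero zero)
  have mult_closed: "a \<otimes>\<^bsub>?R\<^esub> b \<in> carrier ?R" if "a \<in> carrier ?R" "b \<in> carrier ?R" for a b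
    using that by (auto simp: simps intro: free_algebra_mult)
  have left: "essential_left_ideal {y \<in> carrier ?R. y \<otimes>\<^bsub>?R\<^esub> a = \<zero>\<^bsub>?R\<^esub>} ?R \<longleftrightarrow> a = \<zero>\<^bsub>?R\<^esub>"
    if "a \<in> carrier ?R" for a
  proof
    assume ess: "essential_left_ideal {y \<in> carrier ?R. y \<otimes>\<^bsub>?R\<^esub> a = \<zero>\<^bsub>?R\<^esub>} ?R"
    show "a = \<zero>\<^bsub>?R\<^esub>"
    proof (rule ccontr)
      assume "a \<noteq> \<zero>\<^bsub>?R\<^esub>"
      moreover obtain x where "x \<in> ?F" "a = ?q x"
        using \<open>a \<in> carrier ?R\<close> by (auto simp: simps)
      ultimately have x: "x \<in> ?F" "a = ?q x" "x \<notin> ?I"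
        by (simp_all add: simps)
      then obtain u where u: "u \<in> U" "u * x \<notin> ?I"
        using left_unit by blast
      \<comment> \<open>\<open>F\<close> has no unit, so \<open>F u\<close> is only known to contain
        \<open>u * u\<close>, not \<open>u\<close>. Idempotency modulo the ideal is what keeps this
        witness nonzero.\<close>
      define J where "J = ?q ` ((\<lambda>y. y * u) ` ?F)"
      have uF: "u \<in> ?F"
        using u U by blast
      have "additive_subgroup J ?R"
        unfolding J_def
      proof (rule additive_subgroup_presented_algebra)
        show "0 \<in> (\<lambda>y. y * u) ` ?F"
          using free_algebra_zero by (force intro: image_eqI [of _ _ 0])
      next
        fix f g assume "f \<in> (\<lambda>y. y * u) ` ?F" "g \<in> (\<lambda>y. y * u) ` ?F"
        then show "f + g \<in> (\<lambda>y. y * u) ` ?F"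
          by (auto simp: distrib_right [symmetric] intro: free_algebra_add)
      next
        fix f assume "f \<in> (\<lambda>y. y * u) ` ?F"
        then obtain y where "y \<in> ?F" "f = y * u"
          by blast
        then have "- y \<in> ?F" "- f = - y * u"
          by (simp_all add: free_algebra_uminus)
        then show "- f \<in> (\<lambda>y. y * u) ` ?F"
          by blast
      qed (use uF in \<open>auto intro: free_algebra_mult\<close>)
      moreover have "b \<otimes>\<^bsub>?R\<^esub> c \<in> J" if bc: "b \<in> carrier ?R" "c \<in> J" for b c
      proof -
        obtain f y where "f \<in> ?F" "b = ?q f" "y \<in> ?F" "c = ?q (y * u)"
          using bc unfolding carrier_presented_algebra J_def by blast
        then have "b \<otimes>\<^bsub>?R\<^esub> c = ?q ((f * y) * u)" "f * y \<in> ?F"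
          using uF by (simp_all add: mult_presented_algebra [OF S] free_algebra_mult mult.assoc)
        then show ?thesis
          unfolding J_def by blast
      qed
      ultimately have "left_ideal J ?R"
        by (simp add: left_ideal_def)
      moreover have "{y \<in> carrier ?R. y \<otimes>\<^bsub>?R\<^esub> a = \<zero>\<^bsub>?R\<^esub>} \<inter> J = {\<zero>\<^bsub>?R\<^esub>}"
      proof (intro equalityI subsetI)
        fix b assume "b \<in> {y \<in> carrier ?R. y \<otimes>\<^bsub>?R\<^esub> a = \<zero>\<^bsub>?R\<^esub>} \<inter> J"
        then obtain y where y: "y \<in> ?F" "b = ?q (y * u)" "b \<otimes>\<^bsub>?R\<^esub> a = \<zero>\<^bsub>?R\<^esub>"
          unfolding J_def by blast
        then have "y * u * x \<in> ?I"
          using x uF by (simp add: zero_presented_algebra mult_presented_algebra [OF S]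
              coset_eq_iff free_algebra_mult)
        then have "y * u \<in> ?I"
          using local_domain x u y by blast
        then show "b \<in> {\<zero>\<^bsub>?R\<^esub>}"
          using y by (simp add: zero_presented_algebra coset_eq_iff)
      next
        fix b assume "b \<in> {\<zero>\<^bsub>?R\<^esub>}"
        then have "b = \<zero>\<^bsub>?R\<^esub>" "b = ?q (0 * u)"
          by (simp_all add: zero_presented_algebra)
        then have "b \<in> J"
          unfolding J_def using free_algebra_zero by blast
        then show "b \<in> {y \<in> carrier ?R. y \<otimes>\<^bsub>?R\<^esub> a = \<zero>\<^bsub>?R\<^esub>} \<inter> J"
          using \<open>b = \<zero>\<^bsub>?R\<^esub>\<close> that mult_zero \<open>additive_subgroup J ?R\<close> [THEN carrier_J] by blast
      qed
      moreover have "?q (u * u) \<in> J"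
        using uF by (auto simp: J_def)
      then have "J \<noteq> {\<zero>\<^bsub>?R\<^esub>}"
        using nz [of u x] u x by (auto simp: zero_presented_algebra)
      ultimately show False
        using ess by (auto simp: essential_left_ideal_def)
    qed
  next
    assume a: "a = \<zero>\<^bsub>?R\<^esub>"
    then have "{y \<in> carrier ?R. y \<otimes>\<^bsub>?R\<^esub> a = \<zero>\<^bsub>?R\<^esub>} = carrier ?R"
      using mult_zero by auto
    moreover have "J = {\<zero>\<^bsub>?R\<^esub>}" if "left_ideal J ?R" "carrier ?R \<inter> J = {\<zero>\<^bsub>?R\<^esub>}" for J
      using that carrier_J by (auto simp: left_ideal_def)
    ultimately show "essential_left_ideal {y \<in> carrier ?R. y \<otimes>\<^bsub>?R\<^esub> a = \<zero>\<^bsub>?R\<^esub>} ?R"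
      using all mult_closed by (auto simp: essential_left_ideal_def left_ideal_def)
  qed
  have right: "essential_right_ideal {y \<in> carrier ?R. a \<otimes>\<^bsub>?R\<^esub> y = \<zero>\<^bsub>?R\<^esub>} ?R \<longleftrightarrow> a = \<zero>\<^bsub>?R\<^esub>"
    if "a \<in> carrier ?R" for a
  proof
    assume ess: "essential_right_ideal {y \<in> carrier ?R. a \<otimes>\<^bsub>?R\<^esub> y = \<zero>\<^bsub>?R\<^esub>} ?R"
    show "a = \<zero>\<^bsub>?R\<^esub>"
    proof (rule ccontr)
      assume "a \<noteq> \<zero>\<^bsub>?R\<^esub>"
      moreover obtain x where "x \<in> ?F" "a = ?q x"
        using \<open>a \<in> carrier ?R\<close> by (auto simp: simps)
      ultimately have x: "x \<in> ?F" "a = ?q x" "x \<notin> ?I"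
        by (simp_all add: simps)
      then obtain u where u: "u \<in> U" "x * u \<notin> ?I"
        using right_unit by blast
      define J where "J = ?q ` ((\<lambda>y. u * y) ` ?F)"
      have uF: "u \<in> ?F"
        using u U by blast
      have "additive_subgroup J ?R"
        unfolding J_def
      proof (rule additive_subgroup_presented_algebra)
        show "0 \<in> (\<lambda>y. u * y) ` ?F"
          using free_algebra_zero by (force intro: image_eqI [of _ _ 0])
      next
        fix f g assume "f \<in> (\<lambda>y. u * y) ` ?F" "g \<in> (\<lambda>y. u * y) ` ?F"
        then show "f + g \<in> (\<lambda>y. u * y) ` ?F"
          by (auto simp: distrib_left [symmetric] intro: free_algebra_add)
      next
        fix f assume "f \<in> (\<lambda>y. u * y) ` ?F"
        then obtain y where "y \<in> ?F" "f = u * y"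
          by blast
        then have "- y \<in> ?F" "- f = u * - y"
          by (simp_all add: free_algebra_uminus)
        then show "- f \<in> (\<lambda>y. u * y) ` ?F"
          by blast
      qed (use uF in \<open>auto intro: free_algebra_mult\<close>)
      moreover have "c \<otimes>\<^bsub>?R\<^esub> b \<in> J" if bc: "b \<in> carrier ?R" "c \<in> J" for b c
      proof -
        obtain f y where "f \<in> ?F" "b = ?q f" "y \<in> ?F" "c = ?q (u * y)"
          using bc unfolding carrier_presented_algebra J_def by blast
        then have "c \<otimes>\<^bsub>?R\<^esub> b = ?q (u * (y * f))" "y * f \<in> ?F"
          using uF by (simp_all add: mult_presented_algebra [OF S] free_algebra_mult mult.assoc)
        then show ?thesis
          unfolding J_def by blast
      qed
      ultimately have "right_ideal J ?R"
        by (simp add: right_ideal_def)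
      moreover have "{y \<in> carrier ?R. a \<otimes>\<^bsub>?R\<^esub> y = \<zero>\<^bsub>?R\<^esub>} \<inter> J = {\<zero>\<^bsub>?R\<^esub>}"
      proof (intro equalityI subsetI)
        fix b assume "b \<in> {y \<in> carrier ?R. a \<otimes>\<^bsub>?R\<^esub> y = \<zero>\<^bsub>?R\<^esub>} \<inter> J"
        then obtain y where y: "y \<in> ?F" "b = ?q (u * y)" "a \<otimes>\<^bsub>?R\<^esub> b = \<zero>\<^bsub>?R\<^esub>"
          unfolding J_def by blast
        then have "x * u * y \<in> ?I"
          using x uF by (simp add: zero_presented_algebra mult_presented_algebra [OF S]
              coset_eq_iff free_algebra_mult mult.assoc)
        then have "u * y \<in> ?I"
          using local_domain x u y by blast
        then show "b \<in> {\<zero>\<^bsub>?R\<^esub>}"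
          using y by (simp add: zero_presented_algebra coset_eq_iff)
      next
        fix b assume "b \<in> {\<zero>\<^bsub>?R\<^esub>}"
        then have "b = \<zero>\<^bsub>?R\<^esub>" "b = ?q (u * 0)"
          by (simp_all add: zero_presented_algebra)
        then have "b \<in> J"
          unfolding J_def using free_algebra_zero by blast
        then show "b \<in> {y \<in> carrier ?R. a \<otimes>\<^bsub>?R\<^esub> y = \<zero>\<^bsub>?R\<^esub>} \<inter> J"
          using \<open>b = \<zero>\<^bsub>?R\<^esub>\<close> that mult_zero \<open>additive_subgroup J ?R\<close> [THEN carrier_J] by blast
      qed
      moreover have "?q (u * u) \<in> J"
        using uF by (auto simp: J_def)
      then have "J \<noteq> {\<zero>\<^bsub>?R\<^esub>}"
        using nz [of u x] u x by (auto simp: zero_presented_algebra)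
      ultimately show False
        using ess by (auto simp: essential_right_ideal_def)
    qed
  next
    assume a: "a = \<zero>\<^bsub>?R\<^esub>"
    then have "{y \<in> carrier ?R. a \<otimes>\<^bsub>?R\<^esub> y = \<zero>\<^bsub>?R\<^esub>} = carrier ?R"
      using mult_zero by auto
    moreover have "J = {\<zero>\<^bsub>?R\<^esub>}" if "right_ideal J ?R" "carrier ?R \<inter> J = {\<zero>\<^bsub>?R\<^esub>}" for J
      using that carrier_J by (auto simp: right_ideal_def)
    ultimately show "essential_right_ideal {y \<in> carrier ?R. a \<otimes>\<^bsub>?R\<^esub> y = \<zero>\<^bsub>?R\<^esub>} ?R"
      using all mult_closed by (auto simp: essential_right_ideal_def right_ideal_def)
  qed
  show ?thesis
    using left right by (simp add: nonsingular_def left_nonsingular_def right_nonsingular_def)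
qed

section \<open>Normal words of the Leavitt path algebra\<close>

text \<open>Up to exchanging the two indices of ghosts, \<open>Edge\<close> and \<open>Ghost\<close> are treated on an equal footing:
  \<open>arrow (h, b) i j\<close> leads from the \<open>i\<close>-th vertex on its own starting side to the \<open>j\<close>-th vertex on
  the opposite side, and the relations (iii) and (iv) become the single relation
  \<open>\<Sum>\<^sub>k arrow e i k * arrow (flip e) k j = \<delta>\<^sub>i\<^sub>j\<close>.\<close>

fun flip :: "'e \<times> bool \<Rightarrow> 'e \<times> bool" where
  "flip (h, b) = (h, \<not> b)"

lemma flip_flip [simp]: "flip (flip e) = e"
  by (cases e) simp

lemma fst_flip [simp]: "fst (flip e) = fst e"
  by (cases e) simp

lemma flip_eq_flip_iff [simp]: "flip e = flip f \<longleftrightarrow> e = f"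
  by (cases e; cases f) simp

fun arrow :: "'e \<times> bool \<Rightarrow> nat \<Rightarrow> nat \<Rightarrow> ('v, 'e) lpa_gen" where
  "arrow (h, False) i j = Edge h i j"
| "arrow (h, True) i j = Ghost h j i"

text \<open>The values at vertices are dummies: \<open>rmul\<close> tests \<open>cancelling\<close>
  only after excluding vertices, and normal paths consist of valid arrows.\<close>

fun colour :: "('v, 'e) lpa_gen \<Rightarrow> 'e \<times> bool" where
  "colour (Vertex v) = undefined"
| "colour (Edge h i j) = (h, False)"
| "colour (Ghost h i j) = (h, True)"

fun row :: "('v, 'e) lpa_gen \<Rightarrow> nat" where
  "row (Vertex v) = undefined"
| "row (Edge h i j) = i"
| "row (Ghost h i j) = j"

fun col :: "('v, 'e) lpa_gen \<Rightarrow> nat" where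
  "col (Vertex v) = undefined"
| "col (Edge h i j) = j"
| "col (Ghost h i j) = i"

fun is_vertex :: "('v, 'e) lpa_gen \<Rightarrow> bool" where
  "is_vertex (Vertex v) = True"
| "is_vertex _ = False"

lemma arrow_simps [simp]:
  "colour (arrow e i j) = e" "row (arrow e i j) = i" "col (arrow e i j) = j"
  "\<not> is_vertex (arrow e i j)"
  by (cases "(e, i, j)" rule: arrow.cases; simp)+

lemma arrow_eq_iff [simp]: "arrow e i j = arrow f k l \<longleftrightarrow> e = f \<and> i = k \<and> j = l"
  by (metis arrow_simps(1-3))

lemma lpa_gen_cases:
  obtains v where "g = Vertex v" | e i j where "g = arrow e i j"
  by (metis arrow.simps lpa_gen.exhaust)

definition arrow_count :: "('v, 'e) lpa_gen list \<Rightarrow> nat" where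
  "arrow_count w = length (filter (\<lambda>g. \<not> is_vertex g) w)"

lemma arrow_count_simps [simp]:
  "arrow_count [] = 0"
  "arrow_count (g # w) = (if is_vertex g then 0 else 1) + arrow_count w"
  "arrow_count (u @ w) = arrow_count u + arrow_count w"
  by (simp_all add: arrow_count_def)

abbreviation monomial :: "'g list \<Rightarrow> ('g word \<Rightarrow>\<^sub>0 'k::field)" where
  "monomial w \<equiv> Poly_Mapping.single (Word w) 1"

lemma monomial_mult: "monomial u * monomial w = monomial (u @ w)"
  by (simp add: mult_single)

section \<open>Hypergraphs with listings, described by arrows\<close>

locale listed_hypergraph =
  fixes H :: "('v, 'e) hypergraph"
    and sl rl :: "'e \<Rightarrow> 'v list"
  assumes hypergraph: "is_hypergraph H"
    and listing_src: "is_listing (hedges H) (hsrc H) sl"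
    and listing_rng: "is_listing (hedges H) (hrng H) rl"
    and size_ge_2: "\<And>h. h \<in> hedges H \<Longrightarrow> size (hsrc H h) \<ge> 2 \<and> size (hrng H h) \<ge> 2"
begin

definition sz :: "'e \<times> bool \<Rightarrow> nat" where
  "sz e = size (if snd e then hrng H (fst e) else hsrc H (fst e))"

definition vx :: "'e \<times> bool \<Rightarrow> nat \<Rightarrow> 'v" where
  "vx e i = (if snd e then rl (fst e) else sl (fst e)) ! i"

definition valid :: "'e \<times> bool \<Rightarrow> nat \<Rightarrow> nat \<Rightarrow> bool" where
  "valid e i j \<longleftrightarrow> fst e \<in> hedges H \<and> i < sz e \<and> j < sz (flip e)"

definition valid_arrow :: "('v, 'e) lpa_gen \<Rightarrow> bool" where
  "valid_arrow g \<longleftrightarrow> \<not> is_vertex g \<and> valid (colour g) (row g) (col g)"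

lemma valid_arrow_arrow [simp]: "valid_arrow (arrow e i j) \<longleftrightarrow> valid e i j"
  by (simp add: valid_arrow_def)

lemma valid_arrow_Vertex [simp]: "\<not> valid_arrow (Vertex v)"
  by (simp add: valid_arrow_def)

lemma valid_arrowE:
  assumes "valid_arrow g"
  obtains e i j where "g = arrow e i j" "valid e i j"
  using assms by (cases g rule: lpa_gen_cases) (simp_all add: valid_arrow_def)

fun src :: "('v, 'e) lpa_gen \<Rightarrow> 'v" where
  "src (Vertex v) = v"
| "src g = vx (colour g) (row g)"

fun tgt :: "('v, 'e) lpa_gen \<Rightarrow> 'v" where
  "tgt (Vertex v) = v"
| "tgt g = vx (flip (colour g)) (col g)"

lemma src_arrow [simp]: "src (arrow e i j) = vx e i"
  by (cases "(e, i, j)" rule: arrow.cases) simp_all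

lemma tgt_arrow [simp]: "tgt (arrow e i j) = vx (flip e) j"
  by (cases "(e, i, j)" rule: arrow.cases) simp_all

lemma sz_ge_2: "fst e \<in> hedges H \<Longrightarrow> sz e \<ge> 2"
  using size_ge_2 by (simp add: sz_def)

lemma vx_in_hverts: "fst e \<in> hedges H \<Longrightarrow> i < sz e \<Longrightarrow> vx e i \<in> hverts H"
proof -
  assume e: "fst e \<in> hedges H" and i: "i < sz e"
  define l where "l = (if snd e then rl (fst e) else sl (fst e))"
  have l: "mset l = (if snd e then hrng H (fst e) else hsrc H (fst e))"
    using e listing_src listing_rng by (simp add: l_def is_listing_def)
  then have "set_mset (mset l) \<subseteq> hverts H"
    using e hypergraph by (auto simp: is_hypergraph_def Mult_def)
  moreover have "i < length l"
    using i l by (simp add: sz_def flip: size_mset)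
  ultimately show ?thesis
    by (auto simp: vx_def l_def [symmetric])
qed

lemma lpa_gens_iff:
  "g \<in> lpa_gens H \<longleftrightarrow>
     (\<exists>v\<in>hverts H. g = Vertex v) \<or> valid_arrow g"
  by (cases g) (auto simp: lpa_gens_def valid_arrow_def valid_def sz_def)

lemma src_tgt_in_hverts:
  assumes "g \<in> lpa_gens H"
  shows "src g \<in> hverts H" "tgt g \<in> hverts H"
proof -
  from assms consider v where "v \<in> hverts H" "g = Vertex v" | e i j where "g = arrow e i j" "valid e i j"
    by (auto simp: lpa_gens_iff elim: valid_arrowE)
  then have "src g \<in> hverts H \<and> tgt g \<in> hverts H"
    by cases (simp_all add: valid_def vx_in_hverts)
  then show "src g \<in> hverts H" "tgt g \<in> hverts H"
    by simp_all
qed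

text \<open>The relations are oriented so that \<open>arrow e i 0 * arrow (flip e) 0 j\<close> is rewritten.\<close>

definition cancelling :: "('v, 'e) lpa_gen \<Rightarrow> ('v, 'e) lpa_gen \<Rightarrow> bool" where
  "cancelling c d \<longleftrightarrow> colour d = flip (colour c) \<and> col c = 0 \<and> row d = 0"

definition joins :: "('v, 'e) lpa_gen \<Rightarrow> ('v, 'e) lpa_gen \<Rightarrow> bool" where
  "joins c d \<longleftrightarrow> tgt c = src d \<and> \<not> cancelling c d"

section \<open>Normal words and their products with one generator\<close>

definition normal_path :: "('v, 'e) lpa_gen list \<Rightarrow> bool" where
  "normal_path w \<longleftrightarrow> (\<forall>c\<in>set w. valid_arrow c) \<and> successively joins w"

definition normal :: "('v, 'e) lpa_gen list \<Rightarrow> bool" where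
  "normal w \<longleftrightarrow> (\<exists>v\<in>hverts H. w = [Vertex v]) \<or> normal_path w"

text \<open>The normal word for the path \<open>w\<close> multiplied by its end vertex
  \<open>v\<close>: a nonempty path absorbs the vertex, the empty one leaves it.\<close>

definition base :: "('v, 'e) lpa_gen list \<Rightarrow> 'v \<Rightarrow> ('v, 'e) lpa_gen list" where
  "base w v = (if w = [] then [Vertex v] else w)"

text \<open>Rewriting replaces \<open>arrow e i 0\<close> by \<open>arrow e i k\<close>. Its left
  neighbour sees only the start of the arrow, so normality to the left is kept; the next lemma is
  the mirror image for the right neighbour.\<close>

lemma joins_arrow_iff: "joins c (arrow e i j) \<longleftrightarrow> joins c (arrow e i k)"
  by (simp add: joins_def cancelling_def)

lemma arrow_joins_iff: "joins (arrow e i j) d \<longleftrightarrow> joins (arrow e k j) d"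
  by (simp add: joins_def cancelling_def)

lemma normal_path_Nil [simp]: "normal_path []"
  by (simp add: normal_path_def)

lemma normal_path_append_iff:
  "normal_path (u @ w) \<longleftrightarrow> normal_path u \<and> normal_path w \<and> (u = [] \<or> w = [] \<or> joins (last u) (hd w))"
  by (auto simp: normal_path_def successively_append_iff)

lemma normal_path_Cons_iff:
  "normal_path (c # w) \<longleftrightarrow>
     valid_arrow c \<and> normal_path w \<and> (w = [] \<or> joins c (hd w))"
  by (auto simp: normal_path_def successively_Cons)

lemma normal_path_imp_normal: "normal_path w \<Longrightarrow> normal w"
  by (simp add: normal_def)

lemma normal_cases [consumes 1, case_names Nil Vertex path]:
  assumes "normal w"
  obtains "w = []" | v where "v \<in> hverts H" "w = [Vertex v]"
    | a e i j where "w = a @ [arrow e i j]" "valid e i j" "normal_path w"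
proof -
  consider "w = []" | v where "v \<in> hverts H" "w = [Vertex v]" | "normal_path w" "w \<noteq> []"
    using assms by (auto simp: normal_def)
  then show ?thesis
  proof cases
    case 3
    then obtain a c where "w = a @ [c]" "valid_arrow c"
      by (cases w rule: rev_cases) (auto simp: normal_path_def)
    then show ?thesis
      using 3 that(3) by (auto elim: valid_arrowE)
  qed (use that in auto)
qed

text \<open>Meant for normal \<open>w\<close>: only the junction with \<open>g\<close> can then fail
  to be normal. The words with \<open>k \<ge> 1\<close> that replace a cancelling pair are normal
  again, so one rewriting step suffices and no termination argument arises.\<close>

definition rmul :: "('v, 'e) lpa_gen list \<Rightarrow> ('v, 'e) lpa_gen \<Rightarrow> (('v, 'e) lpa_gen word \<Rightarrow>\<^sub>0 'k::field)" where
  "rmul w g =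
    (if w = [] then monomial [g]
     else if tgt (last w) \<noteq> src g then 0
     else if is_vertex (last w) then monomial (butlast w @ [g])
     else if is_vertex g then monomial w
     else if cancelling (last w) g then
       (if row (last w) = col g then monomial (base (butlast w) (src (last w))) else 0)
       - (\<Sum>k\<in>{1..<sz (flip (colour (last w)))}.
            monomial (butlast w @ [arrow (colour (last w)) (row (last w)) k, arrow (colour g) k (col g)]))
     else monomial (w @ [g]))"

lemma rmul_Nil [simp]: "rmul [] g = monomial [g]"
  by (simp add: rmul_def)

lemma rmul_mismatch: "w \<noteq> [] \<Longrightarrow> tgt (last w) \<noteq> src g \<Longrightarrow> rmul w g = 0"
  by (simp add: rmul_def)

lemma rmul_Vertex: "rmul [Vertex u] g = (if u = src g then monomial [g] else 0)"
  by (simp add: rmul_def)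

lemma rmul_path_Vertex:
  "rmul (a @ [arrow e i j]) (Vertex v) = (if vx (flip e) j = v then monomial (a @ [arrow e i j]) else (0 :: _ \<Rightarrow>\<^sub>0 'k::field))"
  by (simp add: rmul_def)

lemma rmul_joins:
  "joins (arrow e i k) (arrow f l j) \<Longrightarrow>
    rmul (a @ [arrow e i k]) (arrow f l j) = monomial (a @ [arrow e i k, arrow f l j])"
  by (simp add: rmul_def joins_def)

lemma rmul_cancelling:
  "rmul (a @ [arrow e i 0]) (arrow (flip e) 0 j) =
     (if i = j then monomial (base a (vx e i)) else (0 :: _ \<Rightarrow>\<^sub>0 'k::field))
     - (\<Sum>k\<in>{1..<sz (flip e)}. monomial (a @ [arrow e i k, arrow (flip e) k j]))"
  by (simp add: rmul_def cancelling_def)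

lemma rmul_path_cases:
  assumes "valid e i k" "valid f l j"
  obtains (mismatch) "vx (flip e) k \<noteq> vx f l"
    | (joins) "vx (flip e) k = vx f l" "joins (arrow e i k) (arrow f l j)"
    | (cancelling) "f = flip e" "k = 0" "l = 0" "vx (flip e) k = vx f l"
  by (metis arrow_simps(1-3) cancelling_def joins_def src_arrow tgt_arrow)

text \<open>The invariants of one multiplication in a bundle: stability of the span of normal words,
  the vertices at both ends, and the filtration degree. The source is fixed only for
  \<open>w \<noteq> []\<close>, since the unit takes over the source of \<open>g\<close>.\<close>

lemma keys_rmul:
  assumes "normal w" "g \<in> lpa_gens H" "z \<in> Poly_Mapping.keys (rmul w g :: _ \<Rightarrow>\<^sub>0 'k::field)"
  shows "normal (letters z)" "letters z \<noteq> []" "tgt (last (letters z)) = tgt g"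
    "w \<noteq> [] \<Longrightarrow> src (hd (letters z)) = src (hd w)"
    "arrow_count (letters z) \<le> arrow_count w + (if is_vertex g then 0 else 1)"
proof -
  have "normal (letters z) \<and> letters z \<noteq> [] \<and> tgt (last (letters z)) = tgt g \<and>
    (w \<noteq> [] \<longrightarrow> src (hd (letters z)) = src (hd w)) \<and>
    arrow_count (letters z) \<le> arrow_count w + (if is_vertex g then 0 else 1)"
    using assms(1)
  proof (cases rule: normal_cases)
    case Nil
    then show ?thesis
      using assms by (auto simp: lpa_gens_iff normal_def normal_path_def)
  next
    case (Vertex v)
    then show ?thesis
      using assms
      by (auto simp: lpa_gens_iff normal_def normal_path_def rmul_Vertex split: if_splits)
  next
    case (path a e i k)
    from assms(2) consider v where "v \<in> hverts H" "g = Vertex v"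
      | f l j where "valid f l j" "g = arrow f l j"
      by (auto simp: lpa_gens_iff elim: valid_arrowE)
    then show ?thesis
    proof cases
      case 1
      then show ?thesis
        using path assms(3) by (auto simp: rmul_path_Vertex normal_def split: if_splits)
    next
      case 2
      from path(2) 2(1) show ?thesis
      proof (cases rule: rmul_path_cases)
        case mismatch
        then show ?thesis
          using 2 path assms(3) by (simp add: rmul_mismatch)
      next
        case joins
        then have "normal_path (w @ [g])"
          using path 2 by (auto simp: normal_path_append_iff normal_path_Cons_iff)
        moreover have "z = Word (a @ [arrow e i k, arrow f l j])"
          using joins path 2 assms(3) by (simp add: rmul_joins)
        ultimately show ?thesis
          using path 2 by (cases a) (simp_all add: normal_path_imp_normal)
      next
        case cancelling
        have a: "normal_path a" "a = [] \<or> joins (last a) (arrow e i 0)"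
          using path cancelling by (auto simp: normal_path_append_iff)
        have "z \<in> Poly_Mapping.keys (if i = j then monomial (base a (vx e i)) else (0 :: _ \<Rightarrow>\<^sub>0 'k)) \<or>
          z \<in> Poly_Mapping.keys (\<Sum>k\<in>{1..<sz (flip e)}.
            monomial (a @ [arrow e i k, arrow (flip e) k j]) :: _ \<Rightarrow>\<^sub>0 'k)"
          using assms(3) path 2 cancelling
          by (auto simp: rmul_cancelling in_keys_iff lookup_minus simp del: One_nat_def)
        then have "i = j \<and> z = Word (base a (vx e i)) \<or>
          z \<in> (\<Union>k\<in>{1..<sz (flip e)}.
            Poly_Mapping.keys (monomial (a @ [arrow e i k, arrow (flip e) k j]) :: _ \<Rightarrow>\<^sub>0 'k))"
          by (rule disj_forward) (simp split: if_splits, erule subsetD [OF keys_sum])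
        then consider "i = j" "z = Word (base a (vx e i))"
          | m where "m \<ge> 1" "m < sz (flip e)" "z = Word (a @ [arrow e i m, arrow (flip e) m j])"
          by (auto simp del: One_nat_def)
        then show ?thesis
        proof cases
          case 1
          then show ?thesis
            using a path 2 cancelling
            by (auto simp: base_def normal_def joins_def valid_def intro: vx_in_hverts)
        next
          case m: 2
          have "joins (arrow e i m) (arrow (flip e) m j)"
            using m by (simp add: joins_def cancelling_def)
          then have "normal_path (a @ [arrow e i m, arrow (flip e) m j])"
            using m a path(2) 2 cancelling joins_arrow_iff [of _ e i m 0]
            by (auto simp: normal_path_append_iff normal_path_Cons_iff valid_def)
          then show ?thesis
            using m path 2 cancelling by (cases a) (auto simp: normal_path_imp_normal)
        qed
      qed
    qed
  qed
  then show "normal (letters z)" "letters z \<noteq> []" "tgt (last (letters z)) = tgt g"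
    "w \<noteq> [] \<Longrightarrow> src (hd (letters z)) = src (hd w)"
    "arrow_count (letters z) \<le> arrow_count w + (if is_vertex g then 0 else 1)"
    by auto
qed

subsection \<open>The action on normal words\<close>

text \<open>The unitization of the Leavitt path algebra acts from the right on the span of the normal
  words, where the empty word is the unit.\<close>

definition ract :: "('v, 'e) lpa_gen \<Rightarrow> (('v, 'e) lpa_gen word \<Rightarrow>\<^sub>0 'k::field) \<Rightarrow> (('v, 'e) lpa_gen word \<Rightarrow>\<^sub>0 'k)"
  where "ract g = linear_extension (\<lambda>w. rmul (letters w) g)"

lemma ract_single [simp]: "ract g (Poly_Mapping.single w c) = scale c (rmul (letters w) g)"
  by (simp add: ract_def)

lemma ract_linear:
  "ract g 0 = 0" "ract g (p + q) = ract g p + ract g q" "ract g (p - q) = ract g p - ract g q"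
  "ract g (scale c p) = scale c (ract g p)" "ract g (\<Sum>i\<in>A. f i) = (\<Sum>i\<in>A. ract g (f i))"
  by (simp_all add: ract_def linear_extension_add linear_extension_diff linear_extension_scale
      linear_extension_sum)

lemma fold_ract_linear:
  "fold ract w 0 = 0" "fold ract w (p + q) = fold ract w p + fold ract w q"
  "fold ract w (p - q) = fold ract w p - fold ract w q"
  "fold ract w (scale c p) = scale c (fold ract w p)"
  "fold ract w (\<Sum>i\<in>A. f i) = (\<Sum>i\<in>A. fold ract w (f i))"
  by (induction w arbitrary: p q f) (simp_all add: ract_linear)

text \<open>\<open>act x p\<close> stands for the product \<open>p x\<close>; hence the reversed
  order in \<open>act_mult\<close>.\<close>

definition act :: "(('v, 'e) lpa_gen word \<Rightarrow>\<^sub>0 'k::field) \<Rightarrow> (('v, 'e) lpa_gen word \<Rightarrow>\<^sub>0 'k) \<Rightarrow> (('v, 'e) lpa_gen word \<Rightarrow>\<^sub>0 'k)"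
  where "act x p = linear_extension (\<lambda>w. fold ract (letters w) p) x"

lemma act_single [simp]: "act (Poly_Mapping.single w c) p = scale c (fold ract (letters w) p)"
  by (simp add: act_def)

lemma act_linear_left:
  "act 0 p = 0" "act (x + y) p = act x p + act y p" "act (x - y) p = act x p - act y p"
  "act (scale c x) p = scale c (act x p)" "act (\<Sum>i\<in>A. f i) p = (\<Sum>i\<in>A. act (f i) p)"
  by (simp_all add: act_def linear_extension_add linear_extension_diff linear_extension_scale
      linear_extension_sum)

lemma act_linear_right:
  "act x 0 = 0" "act x (p + q) = act x p + act x q" "act x (scale c p) = scale c (act x p)"
  by (simp_all add: act_def linear_extension_def fold_ract_linear scale_add_right sum.distrib
      scale_sum mult.commute)

lemma act_gen [simp]: "act (gen g) p = ract g p"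
  by (simp add: gen_def)

lemma act_mult: "act (x * y) p = act y (act x p)"
proof (induction x rule: poly_mapping_linear_induct [OF subset_UNIV])
  case (2 w c)
  show ?case
    by (induction y rule: poly_mapping_linear_induct [OF subset_UNIV])
      (simp_all add: act_linear_left act_linear_right mult_single plus_word_def fold_ract_linear
        distrib_left mult.commute scale_add_right)
qed (simp_all add: act_linear_left act_linear_right distrib_right)

definition normal_span :: "(('v, 'e) lpa_gen word \<Rightarrow>\<^sub>0 'k::field) set" where
  "normal_span = {p. \<forall>z\<in>Poly_Mapping.keys p. normal (letters z)}"

lemma ract_normal_span:
  assumes "p \<in> normal_span" "g \<in> lpa_gens H"
  shows "ract g p \<in> normal_span"
  using assms keys_linear_extension [of "\<lambda>w. rmul (letters w) g" p] keys_rmul(1)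
  unfolding normal_span_def ract_def by blast

lemma fold_ract_normal_span:
  "p \<in> normal_span \<Longrightarrow> set w \<subseteq> lpa_gens H \<Longrightarrow> fold ract w p \<in> normal_span"
  by (induction w arbitrary: p) (simp_all add: ract_normal_span)

lemma act_normal_span:
  assumes "p \<in> normal_span" "x \<in> carrier (free_algebra (lpa_gens H))"
  shows "act x p \<in> normal_span"
  using assms keys_linear_extension [of "\<lambda>w. fold ract (letters w) p" x] fold_ract_normal_span [OF assms(1)]
  unfolding normal_span_def act_def carrier_free_algebra_iff by blast

lemma rmul_Vertex_normal:
  "normal w \<Longrightarrow> w \<noteq> [] \<Longrightarrow> rmul w (Vertex v) = (if tgt (last w) = v then monomial w else 0)"
  by (cases w rule: normal_cases) (auto simp: rmul_Vertex rmul_path_Vertex)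

lemma ract_Vertex:
  assumes "\<And>z. z \<in> Poly_Mapping.keys p \<Longrightarrow> normal (letters z) \<and> letters z \<noteq> [] \<and> tgt (last (letters z)) = v"
  shows "ract (Vertex v) p = p"
proof -
  have "Poly_Mapping.keys p \<subseteq> {z. normal (letters z) \<and> letters z \<noteq> [] \<and> tgt (last (letters z)) = v}"
    using assms by blast
  then show ?thesis
    by (induction p rule: poly_mapping_linear_induct) (auto simp: ract_linear rmul_Vertex_normal)
qed

text \<open>The summand \<open>k = 0\<close> rewrites to the vertex term minus exactly the other
  summands, which are already normal.\<close>

lemma sum_rmul_arrow:
  assumes "fst e \<in> hedges H"
  shows "(\<Sum>k<sz (flip e). rmul (a @ [arrow e i k]) (arrow (flip e) k j)) =
    (if i = j then monomial (base a (vx e i)) else (0 :: _ \<Rightarrow>\<^sub>0 'k::field))"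
proof -
  have n: "{..<sz (flip e)} = insert 0 {1..<sz (flip e)}"
    using sz_ge_2 [of "flip e"] assms by auto
  have "(\<Sum>k\<in>{1..<sz (flip e)}. rmul (a @ [arrow e i k]) (arrow (flip e) k j)) =
      (\<Sum>k\<in>{1..<sz (flip e)}. monomial (a @ [arrow e i k, arrow (flip e) k j]) :: _ \<Rightarrow>\<^sub>0 'k)"
    by (rule sum.cong) (auto intro!: rmul_joins simp: joins_def cancelling_def)
  then show ?thesis
    by (simp add: n rmul_cancelling del: One_nat_def)
qed

text \<open>Relations (iii) and (iv) for the action. Unless \<open>arrow e i k\<close> itself
  cancels against the end of \<open>w\<close>, this is \<open>sum_rmul_arrow\<close> or a mismatch
  of vertices.\<close>

lemma sum_ract_rmul:
  assumes w: "normal w" and e: "fst e \<in> hedges H" and i: "i < sz e" and j: "j < sz e"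
  shows "(\<Sum>k<sz (flip e). ract (arrow (flip e) k j) (rmul w (arrow e i k))) =
    (if i = j then rmul w (Vertex (vx e i)) else (0 :: _ \<Rightarrow>\<^sub>0 'k::field))"
  using w
proof (cases rule: normal_cases)
  case Nil
  then show ?thesis
    using sum_rmul_arrow [where 'k = 'k, OF e, of "[]" i j] by (simp add: base_def)
next
  case (Vertex v)
  then show ?thesis
    using sum_rmul_arrow [where 'k = 'k, OF e, of "[]" i j] by (cases "v = vx e i") (auto simp: base_def rmul_Vertex ract_linear)
next
  case (path a f p l)
  consider "vx (flip f) l \<noteq> vx e i" | "vx (flip f) l = vx e i" "\<not> (e = flip f \<and> l = 0 \<and> i = 0)"
    | "vx (flip f) l = vx e i" "f = flip e" "l = 0" "i = 0"
    by fastforce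
  then show ?thesis
  proof cases
    case 1
    then show ?thesis
      using path by (auto simp: rmul_mismatch rmul_path_Vertex ract_linear)
  next
    case 2
    then have "rmul w (arrow e i k) = (monomial (w @ [arrow e i k]) :: _ \<Rightarrow>\<^sub>0 'k)" for k
      using path by (simp add: rmul_joins joins_def cancelling_def)
    then show ?thesis
      using sum_rmul_arrow [where 'k = 'k, OF e, of w i j] 2 path by (simp add: base_def rmul_path_Vertex)
  next
    \<comment> \<open>The critical overlap: \<open>w\<close> ends in
      \<open>arrow (flip e) p 0\<close>, and every \<open>arrow e 0 k\<close> cancels against it, so
      rewriting starts at the left junction for all \<open>k\<close>.\<close>
    case 3
    have p: "p < sz (flip e)" "fst f \<in> hedges H"
      using path 3 by (auto simp: valid_def)
    have a: "a = [] \<or> joins (last a) (arrow f p 0)"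
      using path 3 by (auto simp: normal_path_append_iff)
    have first: "rmul (base a (vx f p)) (arrow f p j) = (monomial (a @ [arrow f p j]) :: _ \<Rightarrow>\<^sub>0 'k)"
    proof (cases a rule: rev_cases)
      case Nil
      then show ?thesis
        by (simp add: base_def rmul_Vertex)
    next
      case (snoc b c)
      then have "joins c (arrow f p j)" "valid_arrow c"
        using a path joins_arrow_iff [of c f p 0 j] by (auto simp: normal_path_append_iff normal_path_Cons_iff)
      then show ?thesis
        using snoc by (auto simp: base_def rmul_joins elim!: valid_arrowE)
    qed
    have "(\<Sum>k<sz (flip e). ract (arrow (flip e) k j) (rmul w (arrow e i k))) =
      (\<Sum>k<sz (flip e). ract (arrow (flip e) k j)
        ((if p = k then monomial (base a (vx f p)) else 0)
         - (\<Sum>q\<in>{1..<sz e}. monomial (a @ [arrow f p q, arrow e q k]))) :: _ \<Rightarrow>\<^sub>0 'k)"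
      using 3 path rmul_cancelling [where 'k = 'k, of a f p] by simp
    also have "\<dots> = (\<Sum>k<sz (flip e). if p = k then rmul (base a (vx f p)) (arrow f p j) else 0)
        - (\<Sum>k<sz (flip e). \<Sum>q\<in>{1..<sz e}. rmul ((a @ [arrow f p q]) @ [arrow e q k]) (arrow (flip e) k j))"
      unfolding sum_subtractf [symmetric] by (rule sum.cong) (auto simp: ract_linear 3)
    \<comment> \<open>After the exchange the inner sum over \<open>k\<close> is again a relation,
      now behind \<open>arrow f p q\<close>, and leaves only \<open>q = j\<close>. As
      \<open>q\<close> starts at 1, this cancels the first part for \<open>j \<ge> 1\<close> and
      leaves \<open>w\<close> for \<open>j = 0\<close>.\<close>
    also have "(\<Sum>k<sz (flip e). \<Sum>q\<in>{1..<sz e}. rmul ((a @ [arrow f p q]) @ [arrow e q k]) (arrow (flip e) k j)) =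
        (\<Sum>q\<in>{1..<sz e}. if q = j then monomial (a @ [arrow f p q]) else (0 :: _ \<Rightarrow>\<^sub>0 'k))"
      by (subst sum.swap, rule sum.cong [OF refl], subst sum_rmul_arrow [OF e]) (simp add: base_def)
    also have "(\<Sum>k<sz (flip e). if p = k then rmul (base a (vx f p)) (arrow f p j) else 0) =
        (monomial (a @ [arrow f p j]) :: _ \<Rightarrow>\<^sub>0 'k)"
      using p first by simp
    finally show ?thesis
      using 3 path j rmul_path_Vertex [where 'k = 'k, of a f p 0] by auto
  qed
qed

section \<open>The defining relations in terms of arrows\<close>

text \<open>Seven families become four: edges and ghosts merge, and \<open>sum\<close> is (iii) for
  \<open>e = (h, False)\<close> and (iv) for \<open>e = (h, True)\<close>.\<close>

lemma lpa_rels_cases: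
  assumes "r \<in> lpa_rels H sl rl"
  obtains (vertex) u v where "u \<in> hverts H" "v \<in> hverts H"
      "r = gen (Vertex u) * gen (Vertex v) - (if u = v then gen (Vertex u) else 0)"
    | (src) g where "valid_arrow g" "r = gen (Vertex (src g)) * gen g - gen g"
    | (tgt) g where "valid_arrow g" "r = gen g * gen (Vertex (tgt g)) - gen g"
    | (sum) e i j where "fst e \<in> hedges H" "i < sz e" "j < sz e"
      "r = (\<Sum>k<sz (flip e). gen (arrow e i k) * gen (arrow (flip e) k j))
         - (if i = j then gen (Vertex (vx e i)) else 0)"
proof -
  have arrows: "arrow (h, False) i j = Edge h i j" "arrow (h, True) i j = Ghost h j i" for h :: 'e and i j
    by simp_all
  show ?thesis
    using assms unfolding lpa_rels_def
  proof (elim UnE CollectE exE conjE, goal_cases)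
    case (1 u v)
    then show ?thesis using vertex by blast
  next
    case (2 h i j)
    then show ?thesis
      using src [of "Edge h i j"] by (simp add: valid_arrow_def valid_def sz_def vx_def)
  next
    case (3 h i j)
    then show ?thesis
      using tgt [of "Edge h i j"] by (simp add: valid_arrow_def valid_def sz_def vx_def)
  next
    case (4 h i j)
    then show ?thesis
      using src [of "Ghost h i j"] by (simp add: valid_arrow_def valid_def sz_def vx_def)
  next
    case (5 h i j)
    then show ?thesis
      using tgt [of "Ghost h i j"] by (simp add: valid_arrow_def valid_def sz_def vx_def)
  next
    case (6 h i j)
    then show ?thesis
      using sum [of "(h, False)" i j] by (simp add: sz_def vx_def)
  next
    case (7 h i j)
    then show ?thesis
      using sum [of "(h, True)" i j] by (simp add: sz_def vx_def)
  qed
qed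

lemma lpa_rels_vertex:
  "u \<in> hverts H \<Longrightarrow> v \<in> hverts H \<Longrightarrow>
    gen (Vertex u) * gen (Vertex v) - (if u = v then gen (Vertex u) else 0) \<in> lpa_rels H sl rl"
  unfolding lpa_rels_def by blast

lemma lpa_rels_src:
  assumes "valid_arrow g"
  shows "gen (Vertex (src g)) * gen g - gen g \<in> lpa_rels H sl rl"
proof (cases g)
  case (Edge h i j)
  then have "h \<in> hedges H \<and> i < size (hsrc H h) \<and> j < size (hrng H h)"
    using assms by (simp add: valid_arrow_def valid_def sz_def)
  then have "gen (Vertex (sl h ! i)) * gen (Edge h i j) - gen (Edge h i j) \<in> lpa_rels H sl rl"
    unfolding lpa_rels_def by blast
  then show ?thesis
    using Edge by (simp add: vx_def)
next
  case (Ghost h i j)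
  then have "h \<in> hedges H \<and> i < size (hsrc H h) \<and> j < size (hrng H h)"
    using assms by (simp add: valid_arrow_def valid_def sz_def)
  then have "gen (Vertex (rl h ! j)) * gen (Ghost h i j) - gen (Ghost h i j) \<in> lpa_rels H sl rl"
    unfolding lpa_rels_def by blast
  then show ?thesis
    using Ghost by (simp add: vx_def)
qed (use assms in simp)

lemma lpa_rels_tgt:
  assumes "valid_arrow g"
  shows "gen g * gen (Vertex (tgt g)) - gen g \<in> lpa_rels H sl rl"
proof (cases g)
  case (Edge h i j)
  then have "h \<in> hedges H \<and> i < size (hsrc H h) \<and> j < size (hrng H h)"
    using assms by (simp add: valid_arrow_def valid_def sz_def)
  then have "gen (Edge h i j) * gen (Vertex (rl h ! j)) - gen (Edge h i j) \<in> lpa_rels H sl rl"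
    unfolding lpa_rels_def by blast
  then show ?thesis
    using Edge by (simp add: vx_def)
next
  case (Ghost h i j)
  then have "h \<in> hedges H \<and> i < size (hsrc H h) \<and> j < size (hrng H h)"
    using assms by (simp add: valid_arrow_def valid_def sz_def)
  then have "gen (Ghost h i j) * gen (Vertex (sl h ! i)) - gen (Ghost h i j) \<in> lpa_rels H sl rl"
    unfolding lpa_rels_def by blast
  then show ?thesis
    using Ghost by (simp add: vx_def)
qed (use assms in simp)

lemma lpa_rels_sum:
  assumes "fst e \<in> hedges H" "i < sz e" "j < sz e"
  shows "(\<Sum>k<sz (flip e). gen (arrow e i k) * gen (arrow (flip e) k j))
      - (if i = j then gen (Vertex (vx e i)) else 0) \<in> (lpa_rels H sl rl :: (_ \<Rightarrow>\<^sub>0 'k::field) set)"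
proof (cases e)
  case (Pair h b)
  show ?thesis
  proof (cases b)
    case True
    then have "h \<in> hedges H \<and> i < size (hrng H h) \<and> j < size (hrng H h)"
      using assms Pair by (simp add: sz_def)
    then have "(\<Sum>k<size (hsrc H h). gen (Ghost h k i) * gen (Edge h k j))
        - (if i = j then gen (Vertex (rl h ! i)) else 0) \<in> (lpa_rels H sl rl :: (_ \<Rightarrow>\<^sub>0 'k) set)"
      unfolding lpa_rels_def by blast
    then show ?thesis
      using Pair True by (cases "i = j") (simp_all add: sz_def vx_def)
  next
    case False
    then have "h \<in> hedges H \<and> i < size (hsrc H h) \<and> j < size (hsrc H h)"
      using assms Pair by (simp add: sz_def)
    then have "(\<Sum>k<size (hrng H h). gen (Edge h i k) * gen (Ghost h j k))
        - (if i = j then gen (Vertex (sl h ! i)) else 0) \<in> (lpa_rels H sl rl :: (_ \<Rightarrow>\<^sub>0 'k) set)"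
      unfolding lpa_rels_def by blast
    then show ?thesis
      using Pair False by (cases "i = j") (simp_all add: sz_def vx_def)
  qed
qed

text \<open>Takes the place of a confluence check. By linearity one normal word at a time is
  enough.\<close>

lemma act_lpa_rels:
  assumes r: "r \<in> (lpa_rels H sl rl :: (_ \<Rightarrow>\<^sub>0 'k::field) set)" and p: "p \<in> normal_span"
  shows "act r p = 0"
proof -
  have "act r (monomial w) = 0" if w: "normal w" for w
    using r
  proof (cases rule: lpa_rels_cases)
    case (vertex u v)
    then show ?thesis
      by (cases "w = []")
        (auto simp: act_linear_left act_mult rmul_Vertex ract_linear rmul_Vertex_normal [OF w])
  next
    case (src g)
    then show ?thesis
      by (cases "w = []")
        (auto simp: act_linear_left act_mult rmul_Vertex ract_linear rmul_Vertex_normal [OF w] rmul_mismatch)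
  next
    case (tgt g)
    then have g: "g \<in> lpa_gens H"
      by (simp add: lpa_gens_iff)
    have "ract (Vertex (tgt g)) (rmul w g) = (rmul w g :: _ \<Rightarrow>\<^sub>0 'k)"
      by (rule ract_Vertex) (simp add: keys_rmul [OF w g])
    then show ?thesis
      using tgt by (simp add: act_linear_left act_mult)
  next
    case (sum e i j)
    then show ?thesis
      by (simp add: act_linear_left act_mult sum_ract_rmul [OF w])
  qed
  then have act_single_0: "act r (Poly_Mapping.single (Word w) c) = 0" if "normal w" for w c
    using act_linear_right(3) [of r c "monomial w"] that by simp
  have "Poly_Mapping.keys p \<subseteq> {z. normal (letters z)}"
    using p by (auto simp: normal_span_def)
  then show ?thesis
  proof (induction p rule: poly_mapping_linear_induct)
    case (single z c)
    then show ?case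
      using act_single_0 by (cases z) auto
  qed (simp_all add: act_linear_right)
qed

lemma lpa_rels_subset: "lpa_rels H sl rl \<subseteq> carrier (free_algebra (lpa_gens H))"
proof
  fix r assume "r \<in> lpa_rels H sl rl"
  then show "r \<in> carrier (free_algebra (lpa_gens H))"
  proof (cases rule: lpa_rels_cases)
    case (src g)
    then show ?thesis
      using src_tgt_in_hverts [of g] by (auto simp: lpa_gens_iff intro!: free_algebra_closed)
  next
    case (tgt g)
    then show ?thesis
      using src_tgt_in_hverts [of g] by (auto simp: lpa_gens_iff intro!: free_algebra_closed)
  qed (auto simp: lpa_gens_iff valid_def vx_in_hverts intro!: free_algebra_closed)
qed

text \<open>\<open>p\<close> stays arbitrary because \<open>f * a\<close> sends it through
  \<open>act f p\<close> before \<open>a\<close> acts, which is another element of the span.\<close>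

lemma act_ideal_generated:
  assumes "x \<in> ideal_generated (lpa_gens H) (lpa_rels H sl rl)" "p \<in> normal_span"
  shows "act x p = 0"
  using assms
  by (induction arbitrary: p)
    (simp_all add: act_linear_left act_mult act_lpa_rels act_normal_span act_linear_right)

subsection \<open>Normal forms\<close>

abbreviation lpa_ideal :: "(('v, 'e) lpa_gen word \<Rightarrow>\<^sub>0 'k::field) set" where
  "lpa_ideal \<equiv> ideal_generated (lpa_gens H) (lpa_rels H sl rl)"

abbreviation lpa_free :: "(('v, 'e) lpa_gen word \<Rightarrow>\<^sub>0 'k::field) set" where
  "lpa_free \<equiv> carrier (free_algebra (lpa_gens H))"

lemma Vertex_in_lpa_gens [simp]: "Vertex v \<in> lpa_gens H \<longleftrightarrow> v \<in> hverts H"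
  by (simp add: lpa_gens_iff)

lemma valid_arrow_in_lpa_gens: "valid_arrow g \<Longrightarrow> g \<in> lpa_gens H"
  by (simp add: lpa_gens_iff)

text \<open>The empty word is the unit of the ambient algebra but lies outside
  \<open>lpa_free\<close>, so the closure rules of the ideal do not cover it.\<close>

lemma monomial_mult_ideal:
  assumes "set w \<subseteq> lpa_gens H" "x \<in> (lpa_ideal :: (_ \<Rightarrow>\<^sub>0 'k::field) set)"
  shows "monomial w * x \<in> lpa_ideal" "x * monomial w \<in> lpa_ideal"
proof -
  have "monomial w * x \<in> lpa_ideal \<and> x * monomial w \<in> lpa_ideal"
  proof (cases "w = []")
    case True
    then have "(monomial w :: _ \<Rightarrow>\<^sub>0 'k) = 1"
      by (simp flip: zero_word_def)
    then show ?thesis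
      using assms by simp
  next
    case False
    then have "monomial w \<in> (lpa_free :: (_ \<Rightarrow>\<^sub>0 'k) set)"
      using assms by (simp add: carrier_free_algebra_iff)
    then show ?thesis
      using assms by (simp add: ideal_generated.left ideal_generated.right)
  qed
  then show "monomial w * x \<in> lpa_ideal" "x * monomial w \<in> lpa_ideal"
    by simp_all
qed

lemma gen_eq_monomial: "gen g = monomial [g]"
  by (simp add: gen_def)

lemma gen_mult_ideal:
  assumes "g \<in> lpa_gens H" "x \<in> lpa_ideal"
  shows "gen g * x \<in> lpa_ideal" "x * gen g \<in> lpa_ideal"
  using monomial_mult_ideal [of "[g]" x] assms by (simp_all add: gen_eq_monomial)

lemma Vertex_gen_ideal:
  assumes v: "v \<in> hverts H" and g: "g \<in> lpa_gens H"
  shows "gen (Vertex v) * gen g - (if v = src g then gen g else 0) \<in> (lpa_ideal :: (_ \<Rightarrow>\<^sub>0 'k::field) set)"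
proof -
  consider u where "u \<in> hverts H" "g = Vertex u" | "valid_arrow g"
    using g by (auto simp: lpa_gens_iff)
  then show ?thesis
  proof cases
    case 1
    then show ?thesis
      using lpa_rels_vertex [OF v, of u] by (cases "u = v") (auto intro: ideal_generated.base)
  next
    case 2
    have *: "gen (Vertex (src g)) * gen g - gen g \<in> (lpa_ideal :: (_ \<Rightarrow>\<^sub>0 'k) set)"
      by (rule ideal_generated.base [OF lpa_rels_src [OF 2]])
    show ?thesis
    proof (cases "v = src g")
      case False
      then have "gen (Vertex v) * gen (Vertex (src g)) \<in> (lpa_ideal :: (_ \<Rightarrow>\<^sub>0 'k) set)"
        using ideal_generated.base [OF lpa_rels_vertex [OF v src_tgt_in_hverts(1) [OF g]]] by simp
      \<comment> \<open>Here \<open>v g = (v s) g - v (s g - g)\<close> with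
        \<open>s = src g\<close>, and \<open>v s\<close> vanishes modulo the ideal.\<close>
      from ideal_generated_diff [OF gen_mult_ideal(2) [OF g this] gen_mult_ideal(1) [OF _ *, of "Vertex v"]]
      show ?thesis
        using v False by (simp add: algebra_simps)
    qed (use * in simp)
  qed
qed

lemma gen_Vertex_ideal:
  assumes v: "v \<in> hverts H" and g: "g \<in> lpa_gens H"
  shows "gen g * gen (Vertex v) - (if tgt g = v then gen g else 0) \<in> (lpa_ideal :: (_ \<Rightarrow>\<^sub>0 'k::field) set)"
proof -
  consider u where "u \<in> hverts H" "g = Vertex u" | "valid_arrow g"
    using g by (auto simp: lpa_gens_iff)
  then show ?thesis
  proof cases
    case 1
    then show ?thesis
      using lpa_rels_vertex [OF 1(1) v] by (cases "u = v") (auto intro: ideal_generated.base)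
  next
    case 2
    have *: "gen g * gen (Vertex (tgt g)) - gen g \<in> (lpa_ideal :: (_ \<Rightarrow>\<^sub>0 'k) set)"
      by (rule ideal_generated.base [OF lpa_rels_tgt [OF 2]])
    show ?thesis
    proof (cases "tgt g = v")
      case False
      then have "gen (Vertex (tgt g)) * gen (Vertex v) \<in> (lpa_ideal :: (_ \<Rightarrow>\<^sub>0 'k) set)"
        using ideal_generated.base [OF lpa_rels_vertex [OF src_tgt_in_hverts(2) [OF g] v]] by simp
      from ideal_generated_diff [OF gen_mult_ideal(1) [OF g this] gen_mult_ideal(2) [OF _ *, of "Vertex v"]]
      show ?thesis
        using v False by (simp add: algebra_simps)
    qed (use * in simp)
  qed
qed

text \<open>Insert the target of \<open>c\<close>: modulo the ideal \<open>c g\<close> equals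
  \<open>c (tgt c) g\<close>, and \<open>(tgt c) g\<close> vanishes.\<close>

lemma gen_mismatch_ideal:
  assumes c: "c \<in> lpa_gens H" and g: "g \<in> lpa_gens H" and "tgt c \<noteq> src g"
  shows "gen c * gen g \<in> (lpa_ideal :: (_ \<Rightarrow>\<^sub>0 'k::field) set)"
proof -
  have v: "tgt c \<in> hverts H"
    using src_tgt_in_hverts c by blast
  have "gen c * gen (Vertex (tgt c)) - gen c \<in> (lpa_ideal :: (_ \<Rightarrow>\<^sub>0 'k) set)"
    "gen (Vertex (tgt c)) * gen g \<in> (lpa_ideal :: (_ \<Rightarrow>\<^sub>0 'k) set)"
    using gen_Vertex_ideal [OF v c] Vertex_gen_ideal [OF v g] assms by simp_all
  from ideal_generated_diff [OF gen_mult_ideal(1) [OF c this(2)] gen_mult_ideal(2) [OF g this(1)]]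
  show ?thesis
    by (simp add: algebra_simps)
qed

lemma normal_subset_gens: "normal w \<Longrightarrow> set w \<subseteq> lpa_gens H"
  by (auto simp: normal_def normal_path_def valid_arrow_in_lpa_gens)

text \<open>Each branch of \<open>rmul\<close> is a consequence of the relations, so rewriting never
  leaves the coset. Together with the vanishing of the ideal under \<open>act\<close> this makes
  normal forms faithful.\<close>

lemma rmul_ideal:
  assumes w: "normal w" and g: "g \<in> lpa_gens H"
  shows "monomial w * gen g - rmul w g \<in> (lpa_ideal :: (_ \<Rightarrow>\<^sub>0 'k::field) set)"
  using w
proof (cases rule: normal_cases)
  case Nil
  then show ?thesis
    by (simp add: gen_eq_monomial monomial_mult ideal_generated.zero)
next
  case (Vertex v)
  then show ?thesis
    using Vertex_gen_ideal [where 'k = 'k, OF _ g, of v]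
    by (cases "v = src g") (simp_all add: rmul_Vertex gen_eq_monomial)
next
  case (path a e i k)
  have c: "arrow e i k \<in> lpa_gens H"
    using path by (simp add: valid_arrow_in_lpa_gens)
  have a: "set a \<subseteq> lpa_gens H"
    using normal_subset_gens [OF w] path by simp
  have w': "(monomial w :: _ \<Rightarrow>\<^sub>0 'k) = monomial a * gen (arrow e i k)"
    using path by (simp add: gen_eq_monomial monomial_mult)
  consider v where "v \<in> hverts H" "g = Vertex v" | f l j where "valid f l j" "g = arrow f l j"
    using g by (auto simp: lpa_gens_iff elim: valid_arrowE)
  then show ?thesis
  proof cases
    case 1
    have "monomial a * (gen (arrow e i k) * gen (Vertex v)
        - (if vx (flip e) k = v then gen (arrow e i k) else 0)) \<in> (lpa_ideal :: (_ \<Rightarrow>\<^sub>0 'k) set)"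
      using monomial_mult_ideal(1) [OF a gen_Vertex_ideal [OF 1(1) c]] by simp
    then show ?thesis
      using 1 path w' by (cases "vx (flip e) k = v") (simp_all add: rmul_path_Vertex algebra_simps)
  next
    case 2
    from path(2) 2(1) show ?thesis
    proof (cases rule: rmul_path_cases)
      case mismatch
      then have "monomial a * (gen (arrow e i k) * gen g) \<in> (lpa_ideal :: (_ \<Rightarrow>\<^sub>0 'k) set)"
        using 2 by (intro monomial_mult_ideal(1) [OF a] gen_mismatch_ideal [OF c g]) simp
      then show ?thesis
        using mismatch 2 path w' by (simp add: rmul_mismatch mult.assoc)
    next
      case joins
      then show ?thesis
        using 2 path by (simp add: rmul_joins gen_eq_monomial monomial_mult ideal_generated.zero)
    next
      case cancelling
      let ?V = "gen (Vertex (vx e i)) :: _ \<Rightarrow>\<^sub>0 'k"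
      let ?s = "\<lambda>k. gen (arrow e i k) * gen (arrow (flip e) k j) :: _ \<Rightarrow>\<^sub>0 'k"
      have e: "fst e \<in> hedges H" "i < sz e" "j < sz e"
        using path(2) 2(1) cancelling by (auto simp: valid_def)
      have n: "{..<sz (flip e)} = insert 0 {1..<sz (flip e)}"
        using sz_ge_2 [of "flip e"] e by auto
      have 1: "monomial a * ((\<Sum>k<sz (flip e). ?s k) - (if i = j then ?V else 0)) \<in> lpa_ideal"
        using lpa_rels_sum [OF e] by (intro monomial_mult_ideal(1) [OF a] ideal_generated.base)
      have V: "monomial a * ?V - monomial (base a (vx e i)) \<in> lpa_ideal"
      proof (cases a rule: rev_cases)
        case Nil
        then show ?thesis
          by (simp add: base_def gen_eq_monomial monomial_mult ideal_generated.zero)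
      next
        case (snoc b c')
        have c': "c' \<in> lpa_gens H" "set b \<subseteq> lpa_gens H"
          using a snoc by simp_all
        have "tgt c' = vx e i"
          using path snoc by (auto simp: normal_path_append_iff normal_path_Cons_iff joins_def)
        then have "gen c' * ?V - gen c' \<in> lpa_ideal"
          using gen_Vertex_ideal [where 'k = 'k, OF vx_in_hverts [OF e(1,2)] c'(1)] by simp
        then have "monomial b * (gen c' * ?V - gen c') \<in> lpa_ideal"
          by (rule monomial_mult_ideal(1) [OF c'(2)])
        then show ?thesis
          using snoc by (simp add: base_def gen_eq_monomial monomial_mult right_diff_distrib)
      qed
      \<comment> \<open>Two errors add up: the relation of the pair multiplied by \<open>a\<close>
        from the left, and the vertex it yields being absorbed into \<open>base\<close>.\<close>
      have "monomial w * gen g - rmul w g =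
          monomial a * ((\<Sum>k<sz (flip e). ?s k) - (if i = j then ?V else 0))
          + (if i = j then monomial a * ?V - monomial (base a (vx e i)) else 0)"
        using path(1) 2(2) cancelling rmul_cancelling [where 'k = 'k, of a e i j]
        by (simp add: n gen_eq_monomial monomial_mult distrib_left right_diff_distrib sum_distrib_left
            del: One_nat_def)
      then show ?thesis
        using 1 V by (auto intro!: ideal_generated.add ideal_generated.zero)
    qed
  qed
qed

lemma ract_ideal:
  assumes p: "p \<in> normal_span" and g: "g \<in> lpa_gens H"
  shows "p * gen g - ract g p \<in> lpa_ideal"
proof -
  have "Poly_Mapping.keys p \<subseteq> {z. normal (letters z)}"
    using p by (auto simp: normal_span_def)
  then show ?thesis
  proof (induction p rule: poly_mapping_linear_induct)
    case (single z c)
    then have "scale c (monomial (letters z) * gen g - rmul (letters z) g) \<in> lpa_ideal"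
      by (intro ideal_generated.scale rmul_ideal [OF _ g]) simp
    then show ?case
      by (simp add: scale_diff_right mult_scale_left [symmetric])
  next
    case (add f h)
    from ideal_generated.add [OF this] show ?case
      by (simp add: ract_linear algebra_simps)
  qed (simp add: ract_linear ideal_generated.zero)
qed

lemma fold_ract_ideal:
  "p \<in> normal_span \<Longrightarrow> set w \<subseteq> lpa_gens H \<Longrightarrow> p * monomial w - fold ract w p \<in> lpa_ideal"
proof (induction w arbitrary: p)
  case Nil
  then show ?case
    by (simp add: ideal_generated.zero flip: zero_word_def)
next
  case (Cons g w)
  have "(p * gen g - ract g p) * monomial w + (ract g p * monomial w - fold ract w (ract g p)) \<in> lpa_ideal"
    using Cons by (intro ideal_generated.add monomial_mult_ideal(2) ract_ideal Cons.IH ract_normal_span) auto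
  moreover have "p * monomial (g # w) = p * gen g * monomial w"
    by (simp add: gen_eq_monomial mult.assoc monomial_mult)
  ultimately show ?case
    by (simp add: left_diff_distrib)
qed

lemma act_ideal:
  assumes p: "p \<in> normal_span" and x: "x \<in> lpa_free"
  shows "p * x - act x p \<in> lpa_ideal"
proof -
  have "Poly_Mapping.keys x \<subseteq> {z. set (letters z) \<subseteq> lpa_gens H}"
    using x by (auto simp: carrier_free_algebra_iff)
  then show ?thesis
  proof (induction x rule: poly_mapping_linear_induct)
    case (single z c)
    then have "scale c (p * monomial (letters z) - fold ract (letters z) p) \<in> lpa_ideal"
      by (intro ideal_generated.scale fold_ract_ideal [OF p]) simp
    then show ?case
      by (simp add: scale_diff_right mult_scale_right [symmetric])
  next
    case (add f h)
    from ideal_generated.add [OF this] show ?case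
      by (simp add: act_linear_left algebra_simps)
  qed (simp add: act_linear_left ideal_generated.zero)
qed

definition normal_form :: "(('v, 'e) lpa_gen word \<Rightarrow>\<^sub>0 'k::field) \<Rightarrow> (('v, 'e) lpa_gen word \<Rightarrow>\<^sub>0 'k)" where
  "normal_form x = act x 1"

lemma normal_form_mult: "normal_form (x * y) = act y (normal_form x)"
  by (simp add: normal_form_def act_mult)

lemma normal_form_gen: "normal_form (gen g) = monomial [g]"
proof -
  have "normal_form (gen g) = ract g (Poly_Mapping.single 0 1)"
    by (simp add: normal_form_def)
  then show ?thesis
    by (simp only: ract_single scale_one zero_word_def word.sel rmul_Nil)
qed

lemma one_normal_span: "1 \<in> normal_span"
  by (simp add: normal_span_def normal_def zero_word_def)

lemma normal_form_ideal: "x \<in> lpa_free \<Longrightarrow> x - normal_form x \<in> lpa_ideal"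
  using act_ideal [OF one_normal_span] by (simp add: normal_form_def)

text \<open>One direction holds because \<open>x\<close> and its normal form share a coset, the
  other because the ideal annihilates the unit. Vanishing in the quotient thus becomes a question
  about coefficients.\<close>

lemma normal_form_eq_0_iff: "x \<in> lpa_free \<Longrightarrow> normal_form x = 0 \<longleftrightarrow> x \<in> lpa_ideal"
  using normal_form_ideal [of x] act_ideal_generated [OF _ one_normal_span, of x]
  by (auto simp: normal_form_def)

text \<open>Lets a right factor be replaced by its normal form, so that products become
  \<open>act q p\<close> with normal words on both sides.\<close>

lemma act_normal_form:
  assumes "p \<in> normal_span" "x \<in> lpa_free"
  shows "act (normal_form x) p = act x p"
  using act_ideal_generated [OF normal_form_ideal [OF assms(2)] assms(1)]
  by (simp add: act_linear_left)

text \<open>Nonempty words are required because the unit has no source to preserve. \<open>A\<close>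
  is \<open>UNIV\<close> when only degrees matter and \<open>{v}\<close> when the source
  does.\<close>

lemma keys_fold_ract:
  assumes "\<And>z. z \<in> Poly_Mapping.keys p \<Longrightarrow>
      normal (letters z) \<and> letters z \<noteq> [] \<and> src (hd (letters z)) \<in> A \<and> arrow_count (letters z) \<le> n"
    and "set w \<subseteq> lpa_gens H" "z \<in> Poly_Mapping.keys (fold ract w p)"
  shows "normal (letters z) \<and> letters z \<noteq> [] \<and> src (hd (letters z)) \<in> A \<and>
    arrow_count (letters z) \<le> n + arrow_count w"
  using assms
proof (induction w arbitrary: p n)
  case (Cons g w)
  have g: "g \<in> lpa_gens H"
    using Cons.prems by simp
  have "normal (letters y) \<and> letters y \<noteq> [] \<and> src (hd (letters y)) \<in> A \<and>
      arrow_count (letters y) \<le> n + arrow_count [g]" if y: "y \<in> Poly_Mapping.keys (ract g p)" for y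
  proof -
    obtain x where x: "x \<in> Poly_Mapping.keys p" "y \<in> Poly_Mapping.keys (rmul (letters x) g :: _ \<Rightarrow>\<^sub>0 'a)"
      using keys_linear_extension y unfolding ract_def by fast
    then show ?thesis
      using Cons.prems(1) [OF x(1)] keys_rmul [OF _ g x(2)] by force
  qed
  then have "normal (letters z) \<and> letters z \<noteq> [] \<and> src (hd (letters z)) \<in> A \<and>
      arrow_count (letters z) \<le> n + arrow_count [g] + arrow_count w"
    by (rule Cons.IH) (use Cons.prems in auto)
  then show ?case
    by simp
qed simp

lemma keys_ract_normal:
  assumes "p \<in> normal_span" "g \<in> lpa_gens H" "z \<in> Poly_Mapping.keys (ract g p)"
  shows "letters z \<noteq> [] \<and> tgt (last (letters z)) = tgt g"
proof -
  obtain x where x: "x \<in> Poly_Mapping.keys p" "z \<in> Poly_Mapping.keys (rmul (letters x) g :: _ \<Rightarrow>\<^sub>0 'a)"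
    using keys_linear_extension assms(3) unfolding ract_def by fast
  then show ?thesis
    using assms(1,2) keys_rmul [OF _ assms(2) x(2)] by (auto simp: normal_span_def)
qed

text \<open>Words in \<open>lpa_free\<close> have a last letter, and multiplication by a letter
  never returns the empty word.\<close>

lemma keys_normal_form:
  assumes "x \<in> lpa_free" "z \<in> Poly_Mapping.keys (normal_form x)"
  shows "normal (letters z) \<and> letters z \<noteq> []"
proof -
  obtain y where y: "y \<in> Poly_Mapping.keys x"
      "z \<in> Poly_Mapping.keys (fold ract (letters y) 1 :: _ \<Rightarrow>\<^sub>0 'a)"
    using keys_linear_extension assms(2) unfolding normal_form_def act_def by fast
  then obtain w g where w: "letters y = w @ [g]" "set w \<subseteq> lpa_gens H" "g \<in> lpa_gens H"
    using assms(1) by (cases "letters y" rule: rev_cases) (auto simp: carrier_free_algebra_iff)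
  have "fold ract w 1 \<in> (normal_span :: (_ \<Rightarrow>\<^sub>0 'a) set)"
    by (rule fold_ract_normal_span [OF one_normal_span w(2)])
  from keys_ract_normal [OF this w(3), of z] have "letters z \<noteq> []"
    using y w by simp
  moreover have "normal_form x \<in> normal_span"
    using act_normal_span [OF one_normal_span assms(1)] by (simp add: normal_form_def)
  ultimately show ?thesis
    using assms(2) by (simp add: normal_span_def)
qed

lemma fold_ract_normal_path:
  "normal_path (w @ u) \<Longrightarrow> w \<noteq> [] \<Longrightarrow> fold ract u (monomial w) = (monomial (w @ u) :: _ \<Rightarrow>\<^sub>0 'k::field)"
proof (induction u arbitrary: w)
  case (Cons d u)
  obtain a c where w: "w = a @ [c]"
    using Cons.prems(2) by (cases w rule: rev_cases) auto
  have "valid_arrow c" "valid_arrow d" "joins c d" "normal_path ((w @ [d]) @ u)"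
    using Cons.prems w by (auto simp: normal_path_append_iff normal_path_Cons_iff)
  then have "rmul w d = (monomial (w @ [d]) :: _ \<Rightarrow>\<^sub>0 'k)"
    using w by (auto simp: rmul_joins elim!: valid_arrowE)
  then show ?case
    using Cons.IH [of "w @ [d]"] \<open>normal_path ((w @ [d]) @ u)\<close> by simp
qed simp

section \<open>Vertices as projections and local units\<close>

lemma fold_ract_Vertex:
  assumes "normal w" "w \<noteq> []"
  shows "fold ract w (monomial [Vertex v]) = (if src (hd w) = v then monomial w else (0 :: _ \<Rightarrow>\<^sub>0 'k::field))"
proof -
  consider u where "w = [Vertex u]" | "normal_path w"
    using assms by (auto simp: normal_def)
  then show ?thesis
  proof cases
    case 1
    then show ?thesis
      by (simp add: rmul_Vertex)
  next
    case 2
    then obtain d b where w: "w = d # b"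
      using assms by (cases w) auto
    then show ?thesis
      using 2 fold_ract_normal_path [where 'k = 'k, of "[d]" b] by (auto simp: rmul_Vertex fold_ract_linear)
  qed
qed

text \<open>Left multiplication of \<open>q\<close> by \<open>v\<close>: a right action sees a left
  factor as the vector it starts from.\<close>

lemma act_Vertex:
  assumes "\<And>z. z \<in> Poly_Mapping.keys q \<Longrightarrow> normal (letters z) \<and> letters z \<noteq> []"
  shows "act q (monomial [Vertex v]) =
    linear_extension (\<lambda>z. if src (hd (letters z)) = v then Poly_Mapping.single z 1 else 0) q"
  unfolding act_def
proof (rule linear_extension_cong)
  fix z assume "z \<in> Poly_Mapping.keys q"
  then show "fold ract (letters z) (monomial [Vertex v]) =
      (if src (hd (letters z)) = v then Poly_Mapping.single z 1 else 0)"
    using assms by (simp add: fold_ract_Vertex)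
qed

lemma ract_Vertex_select:
  assumes "\<And>z. z \<in> Poly_Mapping.keys p \<Longrightarrow> normal (letters z) \<and> letters z \<noteq> []"
  shows "ract (Vertex v) p =
    linear_extension (\<lambda>z. if tgt (last (letters z)) = v then Poly_Mapping.single z 1 else 0) p"
  unfolding ract_def
proof (rule linear_extension_cong)
  fix z assume "z \<in> Poly_Mapping.keys p"
  then show "rmul (letters z) (Vertex v) =
      (if tgt (last (letters z)) = v then Poly_Mapping.single z 1 else 0)"
    using assms by (simp add: rmul_Vertex_normal)
qed

text \<open>Take the source of any word \<open>z\<close> occurring in the normal form: projecting to
  words with this source keeps the coefficient of \<open>z\<close>.\<close>

lemma Vertex_left_unit:
  assumes x: "x \<in> lpa_free" "x \<notin> lpa_ideal"
  shows "\<exists>v\<in>hverts H. gen (Vertex v) * x \<notin> lpa_ideal"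
proof -
  have "normal_form x \<noteq> 0"
    using x by (simp add: normal_form_eq_0_iff)
  then obtain z where z: "z \<in> Poly_Mapping.keys (normal_form x)"
    by (auto simp flip: keys_eq_empty)
  let ?v = "src (hd (letters z))"
  have v: "?v \<in> hverts H"
    using keys_normal_form [OF x(1) z] normal_subset_gens src_tgt_in_hverts(1) by (meson hd_in_set subsetD)
  have "normal_form (gen (Vertex ?v) * x) = act (normal_form x) (monomial [Vertex ?v])"
    using v x by (subst act_normal_form)
      (auto simp: normal_form_mult normal_form_gen normal_span_def normal_def)
  also have "Poly_Mapping.lookup \<dots> z \<noteq> 0"
    using keys_normal_form [OF x(1)] z
    by (subst act_Vertex) (auto simp: lookup_linear_extension_select in_keys_iff)
  finally have "normal_form (gen (Vertex ?v) * x) \<noteq> 0"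
    by auto
  then have "gen (Vertex ?v) * x \<notin> lpa_ideal"
    using v x by (subst (asm) normal_form_eq_0_iff) (auto intro!: free_algebra_closed)
  then show ?thesis
    using v by blast
qed

lemma Vertex_right_unit:
  assumes x: "x \<in> lpa_free" "x \<notin> lpa_ideal"
  shows "\<exists>v\<in>hverts H. x * gen (Vertex v) \<notin> lpa_ideal"
proof -
  have "normal_form x \<noteq> 0"
    using x by (simp add: normal_form_eq_0_iff)
  then obtain z where z: "z \<in> Poly_Mapping.keys (normal_form x)"
    by (auto simp flip: keys_eq_empty)
  let ?v = "tgt (last (letters z))"
  have v: "?v \<in> hverts H"
    using keys_normal_form [OF x(1) z] normal_subset_gens src_tgt_in_hverts(2) by (meson last_in_set subsetD)
  have "normal_form (x * gen (Vertex ?v)) = ract (Vertex ?v) (normal_form x)"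
    by (simp add: normal_form_mult)
  also have "Poly_Mapping.lookup \<dots> z \<noteq> 0"
    using keys_normal_form [OF x(1)] z
    by (subst ract_Vertex_select) (auto simp: lookup_linear_extension_select in_keys_iff)
  finally have "normal_form (x * gen (Vertex ?v)) \<noteq> 0"
    by auto
  then have "x * gen (Vertex ?v) \<notin> lpa_ideal"
    using v x by (subst (asm) normal_form_eq_0_iff) (auto intro!: free_algebra_closed)
  then show ?thesis
    using v by blast
qed

section \<open>Leading terms\<close>

lemma arrow_count_normal_path: "normal_path w \<Longrightarrow> arrow_count w = length w"
  by (induction w) (auto simp: normal_path_Cons_iff valid_arrow_def)

lemma lookup_fold_ract_eq_0:
  assumes "normal w" "w \<noteq> []" "set u \<subseteq> lpa_gens H" "arrow_count w + arrow_count u < arrow_count (letters z)"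
  shows "Poly_Mapping.lookup (fold ract u (monomial w)) z = (0 :: 'k::field)"
proof (rule ccontr)
  assume "Poly_Mapping.lookup (fold ract u (monomial w)) z \<noteq> (0 :: 'k)"
  then have "z \<in> Poly_Mapping.keys (fold ract u (monomial w) :: _ \<Rightarrow>\<^sub>0 'k)"
    by (simp add: in_keys_iff)
  then have "arrow_count (letters z) \<le> arrow_count w + arrow_count u"
    using keys_fold_ract [of "monomial w :: _ \<Rightarrow>\<^sub>0 'k" UNIV "arrow_count w" u z] assms by simp
  then show False
    using assms by simp
qed

text \<open>Only terms of full length in the product of two normal paths are considered: the term \<open>base a (vx e i)\<close> of
  \<open>rmul_cancelling\<close> drops out.\<close>

lemma lookup_fold_ract_joins:
  assumes "normal_path (a @ [c])" "normal_path (d # b)" "joins c d"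
  shows "Poly_Mapping.lookup (fold ract (d # b) (monomial (a @ [c]))) z =
    (if letters z = a @ c # d # b then 1 else (0 :: 'k::field))"
proof -
  have "normal_path ((a @ [c]) @ d # b)"
    using assms by (auto simp: normal_path_append_iff normal_path_Cons_iff)
  from fold_ract_normal_path [where 'k = 'k, OF this] show ?thesis
    by (cases z) (auto simp: lookup_single when_def)
qed

text \<open>Only the junction is rewritten: \<open>arrow (flip e) k j\<close> joins the rest
  \<open>b\<close> exactly as \<open>arrow (flip e) 0 j\<close> did. The resulting words differ for
  different \<open>k\<close>, so each has coefficient -1.\<close>

lemma lookup_fold_ract_cancelling:
  assumes w: "normal_path (a @ [arrow e i 0])" and u: "normal_path (arrow (flip e) 0 j # b)"
    and z: "arrow_count (letters z) = length a + length b + 2"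
  shows "Poly_Mapping.lookup (fold ract (arrow (flip e) 0 j # b) (monomial (a @ [arrow e i 0]))) z =
    (if \<exists>k\<in>{1..<sz (flip e)}. letters z = a @ arrow e i k # arrow (flip e) k j # b then - 1 else (0 :: 'k::field))"
proof -
  let ?m = "\<lambda>k. a @ arrow e i k # arrow (flip e) k j # b"
  have e: "valid e i 0" "valid (flip e) 0 j"
    using w u by (simp_all add: normal_path_append_iff normal_path_Cons_iff)
  have b: "set b \<subseteq> lpa_gens H" "arrow_count b = length b"
    using u normal_subset_gens [of b] arrow_count_normal_path [of b]
    by (simp_all add: normal_path_Cons_iff normal_def)
  have base: "normal (base a (vx e i))" "base a (vx e i) \<noteq> []" "arrow_count (base a (vx e i)) = length a"
    using w e vx_in_hverts [of e i] arrow_count_normal_path [of a]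
    by (auto simp: base_def normal_def normal_path_append_iff valid_def)
  have path: "fold ract b (monomial (a @ [arrow e i k, arrow (flip e) k j])) = (monomial (?m k) :: _ \<Rightarrow>\<^sub>0 'k)"
    if k: "k \<in> {1..<sz (flip e)}" for k
  proof -
    have "joins (arrow e i k) (arrow (flip e) k j)"
      using k by (simp add: joins_def cancelling_def)
    then have "normal_path ((a @ [arrow e i k, arrow (flip e) k j]) @ b)"
      using w u e k joins_arrow_iff [of _ e i k 0] arrow_joins_iff [of "flip e" 0 j _ k]
      by (auto simp: normal_path_append_iff normal_path_Cons_iff valid_def)
    from fold_ract_normal_path [OF this] show ?thesis
      by simp
  qed
  have "Poly_Mapping.lookup (fold ract b (monomial (base a (vx e i)))) z = (0 :: 'k)"
    by (rule lookup_fold_ract_eq_0) (use base b z in auto)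
  moreover have "fold ract b (- r) = - fold ract b r" for r :: "_ \<Rightarrow>\<^sub>0 'k"
    using fold_ract_linear(3) [of b 0 r] by (simp add: fold_ract_linear(1))
  ultimately have "Poly_Mapping.lookup (fold ract (arrow (flip e) 0 j # b) (monomial (a @ [arrow e i 0]))) z =
      - (\<Sum>k\<in>{1..<sz (flip e)}. Poly_Mapping.lookup (monomial (?m k)) z :: 'k)"
    using path
    by (cases "i = j") (simp_all add: rmul_cancelling fold_ract_linear lookup_minus lookup_sum del: One_nat_def)
  also have "(\<Sum>k\<in>{1..<sz (flip e)}. Poly_Mapping.lookup (monomial (?m k)) z :: 'k) =
      (if \<exists>k\<in>{1..<sz (flip e)}. letters z = ?m k then 1 else 0)"
  proof (cases "\<exists>k\<in>{1..<sz (flip e)}. letters z = ?m k")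
    case True
    then obtain l where l: "l \<in> {1..<sz (flip e)}" "letters z = ?m l"
      by blast
    then have "Poly_Mapping.lookup (monomial (?m k)) z = (if k = l then 1 else (0 :: 'k))" for k
      by (cases z) (auto simp: lookup_single when_def)
    then show ?thesis
      using l by auto
  next
    case False
    then show ?thesis
      by (cases z) (auto simp: lookup_single when_def intro!: sum.neutral)
  qed
  finally show ?thesis
    by simp
qed

section \<open>Nonvanishing through a term of unique origin\<close>

lemma act_expand:
  "Poly_Mapping.lookup (act q p) z = (\<Sum>(w, u)\<in>Poly_Mapping.keys p \<times> Poly_Mapping.keys q.
    Poly_Mapping.lookup p w * Poly_Mapping.lookup q u *
    Poly_Mapping.lookup (fold ract (letters u) (Poly_Mapping.single w 1)) z)"
proof -
  have "fold ract u p = linear_extension (\<lambda>w. fold ract u (Poly_Mapping.single w 1)) p" for u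
    by (induction p rule: poly_mapping_linear_induct [OF subset_UNIV])
      (simp_all add: fold_ract_linear linear_extension_add fold_ract_linear(4) [symmetric])
  then have "Poly_Mapping.lookup (act q p) z = (\<Sum>u\<in>Poly_Mapping.keys q. \<Sum>w\<in>Poly_Mapping.keys p.
    Poly_Mapping.lookup p w * Poly_Mapping.lookup q u *
    Poly_Mapping.lookup (fold ract (letters u) (Poly_Mapping.single w 1)) z)"
    by (simp add: act_def lookup_linear_extension sum_distrib_left mult_ac)
  then show ?thesis
    by (subst (asm) sum.swap) (simp add: sum.cartesian_product)
qed

text \<open>Nothing can cancel at \<open>z\<close>: its coefficient is a product of three nonzero
  elements of a field.\<close>

lemma act_neq_0_by_unique_term:
  assumes "w \<in> Poly_Mapping.keys p" "u \<in> Poly_Mapping.keys q"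
    and "Poly_Mapping.lookup (fold ract (letters u) (Poly_Mapping.single w 1)) z \<noteq> (0 :: 'k::field)"
    and unique: "\<And>w' u'. w' \<in> Poly_Mapping.keys p \<Longrightarrow> u' \<in> Poly_Mapping.keys q \<Longrightarrow>
      Poly_Mapping.lookup (fold ract (letters u') (Poly_Mapping.single w' 1)) z \<noteq> (0 :: 'k) \<Longrightarrow> w' = w \<and> u' = u"
  shows "act q p \<noteq> (0 :: _ \<Rightarrow>\<^sub>0 'k)"
proof -
  have "Poly_Mapping.lookup (act q p) z = (\<Sum>(w, u)\<in>{(w, u)}.
    Poly_Mapping.lookup p w * Poly_Mapping.lookup q u *
    Poly_Mapping.lookup (fold ract (letters u) (Poly_Mapping.single w 1)) z)"
    unfolding act_expand
  proof (rule sum.mono_neutral_right)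
    show "\<forall>i\<in>Poly_Mapping.keys p \<times> Poly_Mapping.keys q - {(w, u)}. (case i of (w', u') \<Rightarrow>
      Poly_Mapping.lookup p w' * Poly_Mapping.lookup q u' *
      Poly_Mapping.lookup (fold ract (letters u') (Poly_Mapping.single w' 1)) z) = 0"
    proof
      fix i assume "i \<in> Poly_Mapping.keys p \<times> Poly_Mapping.keys q - {(w, u)}"
      then obtain w' u' where i: "i = (w', u')" "w' \<in> Poly_Mapping.keys p" "u' \<in> Poly_Mapping.keys q"
          "\<not> (w' = w \<and> u' = u)"
        by blast
      then have "Poly_Mapping.lookup (fold ract (letters u') (Poly_Mapping.single w' 1)) z = (0 :: 'k)"
        using unique by blast
      then show "(case i of (w', u') \<Rightarrow>
        Poly_Mapping.lookup p w' * Poly_Mapping.lookup q u' *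
        Poly_Mapping.lookup (fold ract (letters u') (Poly_Mapping.single w' 1)) z) = 0"
        by (simp add: i)
    qed
  qed (use assms(1,2) in simp_all)
  also have "\<dots> \<noteq> 0"
    using assms(1-3) by (simp add: in_keys_iff)
  finally show ?thesis
    by auto
qed

text \<open>\<open>cancelling\<close> with an arbitrary common index instead of 0; exactly such
  pairs are left at the junction after a cancelling pair is rewritten.\<close>

definition matched :: "('v, 'e) lpa_gen \<Rightarrow> ('v, 'e) lpa_gen \<Rightarrow> bool" where
  "matched c d \<longleftrightarrow> colour d = flip (colour c) \<and> col c = row d"

text \<open>Apart from \<open>w @ u\<close> itself, the product of two normal paths has full-length terms only
  where \<open>matched\<close> letters meet. If some top terms of \<open>p\<close> and \<open>q\<close> meet in letters that are not
  matched, their concatenation has no other source. Otherwise all top terms meet in the same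
  column, and a single rewriting step still leaves a term of unique origin; this is where
  \<open>|s(h)|, |r(h)| \<ge> 2\<close> is needed.\<close>

lemma act_neq_0:
  fixes p q :: "('v, 'e) lpa_gen word \<Rightarrow>\<^sub>0 'k::field"
  assumes p: "p \<noteq> 0" "\<And>z. z \<in> Poly_Mapping.keys p \<Longrightarrow> normal (letters z) \<and> letters z \<noteq> [] \<and> tgt (last (letters z)) = v"
    and q: "q \<noteq> 0" "\<And>z. z \<in> Poly_Mapping.keys q \<Longrightarrow> normal (letters z) \<and> letters z \<noteq> [] \<and> src (hd (letters z)) = v"
  shows "act q p \<noteq> 0"
proof -
  define m where "m = Max (arrow_count ` letters ` Poly_Mapping.keys p)"
  define n where "n = Max (arrow_count ` letters ` Poly_Mapping.keys q)"
  have keys: "Poly_Mapping.keys p \<noteq> {}" "Poly_Mapping.keys q \<noteq> {}"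
    using p q by auto
  have m: "arrow_count (letters w) \<le> m" if "w \<in> Poly_Mapping.keys p" for w
    unfolding m_def by (rule Max_ge) (use that in auto)
  have n: "arrow_count (letters u) \<le> n" if "u \<in> Poly_Mapping.keys q" for u
    unfolding n_def by (rule Max_ge) (use that in auto)
  have "m \<in> arrow_count ` letters ` Poly_Mapping.keys p"
    unfolding m_def by (rule Max_in) (use keys in auto)
  then obtain w0 where w0: "w0 \<in> Poly_Mapping.keys p" "arrow_count (letters w0) = m"
    by auto
  have "n \<in> arrow_count ` letters ` Poly_Mapping.keys q"
    unfolding n_def by (rule Max_in) (use keys in auto)
  then obtain u0 where u0: "u0 \<in> Poly_Mapping.keys q" "arrow_count (letters u0) = n"
    by auto
  have vertex: "letters z = [Vertex v]"
    if "normal (letters z)" "arrow_count (letters z) = 0" "letters z \<noteq> []"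
      "tgt (last (letters z)) = v \<or> src (hd (letters z)) = v" for z
    using that arrow_count_normal_path [of "letters z"] by (auto simp: normal_def)
  have single: "r = Poly_Mapping.single (Word [Vertex v]) (Poly_Mapping.lookup r (Word [Vertex v]))"
    if "\<And>z. z \<in> Poly_Mapping.keys r \<Longrightarrow> letters z = [Vertex v]" for r :: "_ \<Rightarrow>\<^sub>0 'k"
  proof -
    have "z = Word [Vertex v]" if "z \<in> Poly_Mapping.keys r" for z
      using \<open>\<And>z. z \<in> Poly_Mapping.keys r \<Longrightarrow> letters z = [Vertex v]\<close> [OF that] by (cases z) simp
    then show ?thesis
      by (intro poly_mapping_eqI) (auto simp: lookup_single when_def in_keys_iff)
  qed
  \<comment> \<open>In degree 0 a factor is a scalar multiple of \<open>v\<close>, which is neutral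
    for the other factor. In positive degree the top words are paths.\<close>
  consider "m = 0" | "n = 0" | "m > 0" "n > 0"
    by auto
  then show ?thesis
  proof cases
    case 1
    define c where "c = Poly_Mapping.lookup p (Word [Vertex v])"
    have "p = Poly_Mapping.single (Word [Vertex v]) c"
      unfolding c_def by (rule single) (use p(2) m vertex 1 in auto)
    then have p': "p = scale c (monomial [Vertex v])" "c \<noteq> 0"
      using p by auto
    have "Poly_Mapping.lookup (act q (monomial [Vertex v])) u0 \<noteq> 0"
      using q u0 by (subst act_Vertex) (auto simp: lookup_linear_extension_select in_keys_iff)
    then have "Poly_Mapping.lookup (act q p) u0 \<noteq> 0"
      using p' by (simp add: act_linear_right del: scale_single)
    then show ?thesis
      by auto
  next
    case 2
    define c where "c = Poly_Mapping.lookup q (Word [Vertex v])"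
    have "q = Poly_Mapping.single (Word [Vertex v]) c"
      unfolding c_def by (rule single) (use q(2) n vertex 2 in auto)
    then have "c \<noteq> 0" "act q p = scale c (ract (Vertex v) p)"
      using q by auto
    moreover have "ract (Vertex v) p = p"
      by (rule ract_Vertex) (use p in auto)
    ultimately have "Poly_Mapping.lookup (act q p) w0 \<noteq> 0"
      using w0 by (simp add: in_keys_iff)
    then show ?thesis
      by auto
  next
    case 3
    define P where "P = {w \<in> Poly_Mapping.keys p. arrow_count (letters w) = m}"
    define Q where "Q = {u \<in> Poly_Mapping.keys q. arrow_count (letters u) = n}"
    let ?T = "\<lambda>w u. Poly_Mapping.lookup (fold ract (letters u) (Poly_Mapping.single w 1)) :: _ \<Rightarrow> 'k"
    have P: "normal_path (letters w)" "length (letters w) = m" "letters w \<noteq> []" "tgt (last (letters w)) = v"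
      "w \<in> Poly_Mapping.keys p" if "w \<in> P" for w
      using that p(2) [of w] 3 arrow_count_normal_path [of "letters w"] by (auto simp: P_def normal_def)
    have Q: "normal_path (letters u)" "length (letters u) = n" "letters u \<noteq> []" "src (hd (letters u)) = v"
      "u \<in> Poly_Mapping.keys q" if "u \<in> Q" for u
      using that q(2) [of u] 3 arrow_count_normal_path [of "letters u"] by (auto simp: Q_def normal_def)
    have T: "?T w u z =
      (if joins (last (letters w)) (hd (letters u))
       then (if letters z = letters w @ letters u then 1 else 0)
       else (if \<exists>k\<in>{1..<sz (flip (colour (last (letters w))))}. letters z = butlast (letters w)
            @ arrow (colour (last (letters w))) (row (last (letters w))) k
            # arrow (colour (hd (letters u))) k (col (hd (letters u))) # tl (letters u) then - 1 else 0))"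
      if w: "w \<in> P" and u: "u \<in> Q" and z: "arrow_count (letters z) = m + n" for w u z
    proof -
      obtain a c where ac: "letters w = a @ [c]"
        using P(3) [OF w] by (cases "letters w" rule: rev_cases) auto
      obtain d b where db: "letters u = d # b"
        using Q(3) [OF u] by (cases "letters u") auto
      have w': "Poly_Mapping.single w 1 = (monomial (a @ [c]) :: _ \<Rightarrow>\<^sub>0 'k)"
        using ac by (cases w) simp
      have len: "m = length a + 1" "n = length b + 1"
        using P(2) [OF w] Q(2) [OF u] ac db by simp_all
      show ?thesis
      proof (cases "joins c d")
        case True
        then show ?thesis
          using lookup_fold_ract_joins [where 'k = 'k, of a c d b z] P(1) [OF w] Q(1) [OF u] ac db w' by simp
      next
        case False
        have "valid_arrow c" "valid_arrow d"
          using P(1) [OF w] Q(1) [OF u] ac db by (auto simp: normal_path_append_iff normal_path_Cons_iff)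
        then obtain e i k f l j where c: "c = arrow e i k" and d: "d = arrow f l j"
          by (auto elim!: valid_arrowE)
        \<comment> \<open>All words in \<open>P\<close> end and all words in \<open>Q\<close> start
          at \<open>v\<close>, so cancellation is the only obstruction to joining.\<close>
        have "cancelling c d"
          using False P(4) [OF w] Q(4) [OF u] ac db by (simp add: joins_def)
        then have "k = 0" "l = 0" "f = flip e"
          using c d by (simp_all add: cancelling_def)
        then show ?thesis
          using lookup_fold_ract_cancelling [where 'k = 'k, of a e i j b z]
            P(1) [OF w] Q(1) [OF u] ac db w' False c d z len by simp
      qed
    qed
    have top: "w \<in> P \<and> u \<in> Q"
      if "w \<in> Poly_Mapping.keys p" "u \<in> Poly_Mapping.keys q" "arrow_count (letters z) = m + n" "?T w u z \<noteq> 0" for w u z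
    proof (rule ccontr)
      assume "\<not> (w \<in> P \<and> u \<in> Q)"
      then have "arrow_count (letters w) + arrow_count (letters u) < m + n"
        using m [OF that(1)] n [OF that(2)] that(1,2) by (auto simp: P_def Q_def)
      then have "?T w u z = 0"
        using lookup_fold_ract_eq_0 [where 'k = 'k, of "letters w" "letters u" z] p(2) [OF that(1)] q(2) [OF that(2)]
          normal_subset_gens [of "letters u"] that(3) by simp
      then show False
        using that by simp
    qed
    have unique: "act q p \<noteq> 0" if w: "w \<in> P" and u: "u \<in> Q" and z: "arrow_count (letters z) = m + n"
      and nz: "?T w u z \<noteq> 0"
      and un: "\<And>w' u'. w' \<in> P \<Longrightarrow> u' \<in> Q \<Longrightarrow> ?T w' u' z \<noteq> 0 \<Longrightarrow>
        letters w' = letters w \<and> letters u' = letters u" for w u z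
    proof (rule act_neq_0_by_unique_term [OF P(5) [OF w] Q(5) [OF u] nz])
      fix w' u' assume *: "w' \<in> Poly_Mapping.keys p" "u' \<in> Poly_Mapping.keys q" "?T w' u' z \<noteq> 0"
      then have "w' \<in> P" "u' \<in> Q"
        using top [OF *(1,2) z *(3)] by simp_all
      from un [OF this *(3)] show "w' = w \<and> u' = u"
        by (simp add: word.expand)
    qed
    have PQ: "w0 \<in> P" "u0 \<in> Q"
      using w0 u0 by (simp_all add: P_def Q_def)
    have arrow: "c = arrow (colour c) (row c) (col c)" if "valid_arrow c" for c
      using that by (auto elim: valid_arrowE)
    have last_hd: "valid_arrow (last (letters w))" "valid_arrow (hd (letters u))" if "w \<in> P" "u \<in> Q" for w u
      using P(1,3) [OF that(1)] Q(1,3) [OF that(2)] by (simp_all add: normal_path_def)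
    have joins_iff: "joins (last (letters w)) (hd (letters u)) \<longleftrightarrow>
        \<not> cancelling (last (letters w)) (hd (letters u))" if "w \<in> P" "u \<in> Q" for w u
      using P(4) [OF that(1)] Q(4) [OF that(2)] by (simp add: joins_def)
    show ?thesis
    proof (cases "\<exists>w\<in>P. \<exists>u\<in>Q. \<not> cancelling (last (letters w)) (hd (letters u)) \<and>
        (matched (last (letters w)) (hd (letters u)) \<longrightarrow> (\<forall>w'\<in>P. \<forall>u'\<in>Q. \<not> cancelling (last (letters w')) (hd (letters u'))))")
      case True
      then obtain w u where wu: "w \<in> P" "u \<in> Q" "\<not> cancelling (last (letters w)) (hd (letters u))"
        and *: "matched (last (letters w)) (hd (letters u)) \<Longrightarrow> w' \<in> P \<Longrightarrow> u' \<in> Q \<Longrightarrow>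
          \<not> cancelling (last (letters w')) (hd (letters u'))" for w' u'
        by blast
      define z where "z = Word (letters w @ letters u)"
      have z: "arrow_count (letters z) = m + n"
        using wu P(1,2) [OF wu(1)] Q(1,2) [OF wu(2)] arrow_count_normal_path by (simp add: z_def)
      show ?thesis
      proof (rule unique [OF wu(1,2) z])
        show "?T w u z \<noteq> 0"
          using T [OF wu(1,2) z] wu joins_iff by (simp add: z_def)
      next
        fix w' u' assume w'u': "w' \<in> P" "u' \<in> Q" and nz: "?T w' u' z \<noteq> 0"
        show "letters w' = letters w \<and> letters u' = letters u"
        proof (cases "joins (last (letters w')) (hd (letters u'))")
          case True
          then have "letters w @ letters u = letters w' @ letters u'"
            using nz T [OF w'u' z] by (simp add: z_def split: if_splits)
          then show ?thesis
            using P(2) [OF wu(1)] P(2) [OF w'u'(1)] by simp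
        next
          \<comment> \<open>A rewritten pair would put matched letters at the junction of
            \<open>z\<close>, which sits at the same place for all pairs because the words of
            \<open>P\<close> have equal length. So \<open>w\<close>, \<open>u\<close> would be
            matched while \<open>w'\<close>, \<open>u'\<close> cancel, against the choice of
            \<open>w\<close>, \<open>u\<close>.\<close>
          case False
          then obtain k where "letters w @ letters u = butlast (letters w')
            @ arrow (colour (last (letters w'))) (row (last (letters w'))) k
            # arrow (colour (hd (letters u'))) k (col (hd (letters u'))) # tl (letters u')"
            using nz T [OF w'u' z] by (auto simp: z_def split: if_splits)
          then have "letters w @ letters u = (butlast (letters w')
            @ [arrow (colour (last (letters w'))) (row (last (letters w'))) k])
            @ arrow (colour (hd (letters u'))) k (col (hd (letters u'))) # tl (letters u')"
            by simp
          moreover have "length (letters w) = length (butlast (letters w')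
            @ [arrow (colour (last (letters w'))) (row (last (letters w'))) k])"
            using P(2,3) [OF wu(1)] P(2,3) [OF w'u'(1)] by (cases "letters w'" rule: rev_cases) simp_all
          ultimately have "letters w = butlast (letters w')
            @ [arrow (colour (last (letters w'))) (row (last (letters w'))) k]"
            "letters u = arrow (colour (hd (letters u'))) k (col (hd (letters u'))) # tl (letters u')"
            by (simp_all del: append_assoc)
          then have "colour (last (letters w)) = colour (last (letters w'))" "col (last (letters w)) = k"
            "colour (hd (letters u)) = colour (hd (letters u'))" "row (hd (letters u)) = k"
            by simp_all
          moreover have "cancelling (last (letters w')) (hd (letters u'))"
            using joins_iff [OF w'u'] False by simp
          ultimately have False
            using * [OF _ w'u'] by (simp add: matched_def cancelling_def)
          then show ?thesis ..
        qed
      qed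
    next
      case False
      moreover have "matched c d" if "cancelling c d" for c d
        using that by (simp add: matched_def cancelling_def)
      ultimately have all: "w \<in> P \<Longrightarrow> u \<in> Q \<Longrightarrow> matched (last (letters w)) (hd (letters u))" for w u
        by blast
      from False have "\<exists>w\<in>P. \<exists>u\<in>Q. cancelling (last (letters w)) (hd (letters u))"
        using PQ by blast
      then obtain w u where wu: "w \<in> P" "u \<in> Q" "cancelling (last (letters w)) (hd (letters u))"
        by blast
      \<comment> \<open>One cancelling pair forces all: \<open>u'\<close> is matched with
        \<open>w\<close>, so its row is 0, and \<open>w'\<close> is matched with \<open>u\<close>,
        so its column is 0.\<close>
      have canc: "cancelling (last (letters w')) (hd (letters u'))" if "w' \<in> P" "u' \<in> Q" for w' u'
        using all [OF wu(1) that(2)] all [OF that(1) wu(2)] all [OF that] wu(3)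
        by (simp add: matched_def cancelling_def)
      define e where "e = colour (last (letters w))"
      have colours: "colour (last (letters w')) = e" "col (last (letters w')) = 0"
        "colour (hd (letters u')) = flip e" "row (hd (letters u')) = 0" if "w' \<in> P" "u' \<in> Q" for w' u'
        using canc [OF that] canc [OF that(1) wu(2)] wu(3) by (auto simp: cancelling_def e_def)
      have w_eq: "letters w' = butlast (letters w') @ [arrow e (row (last (letters w'))) 0]"
        "letters u' = arrow (flip e) 0 (col (hd (letters u'))) # tl (letters u')" if "w' \<in> P" "u' \<in> Q" for w' u'
        using arrow [OF last_hd(1) [OF that]] arrow [OF last_hd(2) [OF that]] colours [OF that]
          P(3) [OF that(1)] Q(3) [OF that(2)] by simp_all
      have "fst e \<in> hedges H"
        using last_hd(1) [OF wu(1,2)] by (simp add: valid_arrow_def valid_def e_def)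
      then have sz: "1 \<in> {1..<sz (flip e)}"
        using sz_ge_2 [of "flip e"] by auto
      \<comment> \<open>The term \<open>k = 1\<close> of the rewriting, available since sizes are at
        least 2. Every top pair is rewritten, and rewriting changes only the two indices 0 at the
        junction, so \<open>z\<close> determines \<open>w\<close> and \<open>u\<close>.\<close>
      define z where "z = Word (butlast (letters w) @ arrow e (row (last (letters w))) 1
        # arrow (flip e) 1 (col (hd (letters u))) # tl (letters u))"
      have z: "arrow_count (letters z) = m + n"
        using wu arg_cong [OF w_eq(1) [OF wu(1,2)], of arrow_count]
          arg_cong [OF w_eq(2) [OF wu(1,2)], of arrow_count]
        by (simp add: z_def P_def Q_def)
      show ?thesis
      proof (rule unique [OF wu(1,2) z])
        show "?T w u z \<noteq> 0"
          using T [OF wu(1,2) z] joins_iff [OF wu(1,2)] wu(3) sz colours [OF wu(1,2)]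
          by (auto simp: z_def)
      next
        fix w' u' assume w'u': "w' \<in> P" "u' \<in> Q" and nz: "?T w' u' z \<noteq> 0"
        then obtain k where "letters z = butlast (letters w')
            @ arrow e (row (last (letters w'))) k
            # arrow (flip e) k (col (hd (letters u'))) # tl (letters u')"
          using T [OF w'u' z] joins_iff [OF w'u'] canc [OF w'u'] colours [OF w'u'] by (auto split: if_splits)
        moreover have "length (butlast (letters w)) = length (butlast (letters w'))"
          using P(2) [OF wu(1)] P(2) [OF w'u'(1)] by simp
        ultimately have "butlast (letters w) = butlast (letters w')" "row (last (letters w)) = row (last (letters w'))"
          "col (hd (letters u)) = col (hd (letters u'))" "tl (letters u) = tl (letters u')"
          by (simp_all add: z_def)
        then show "letters w' = letters w \<and> letters u' = letters u"
          using w_eq [OF wu(1,2)] w_eq [OF w'u'] by metis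
      qed
    qed
  qed
qed

text \<open>With \<open>p\<close> and \<open>q\<close> the normal forms of \<open>x v\<close> and
  \<open>v y\<close>, \<open>act q p\<close> is the normal form of \<open>x v y\<close>, because
  \<open>p v = p\<close>. All words of \<open>p\<close> end at \<open>v\<close> and all words of
  \<open>q\<close> start there, as \<open>act_neq_0\<close> demands.\<close>

lemma lpa_local_domain:
  assumes x: "x \<in> lpa_free" and y: "y \<in> lpa_free" and v: "v \<in> hverts H"
    and xy: "x * gen (Vertex v) * y \<in> (lpa_ideal :: (_ \<Rightarrow>\<^sub>0 'k::field) set)"
  shows "x * gen (Vertex v) \<in> lpa_ideal \<or> gen (Vertex v) * y \<in> lpa_ideal"
proof (rule ccontr)
  assume neg: "\<not> ?thesis"
  let ?V = "gen (Vertex v) :: _ \<Rightarrow>\<^sub>0 'k"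
  have V: "?V \<in> lpa_free"
    using v by (simp add: free_algebra_gen)
  have xV: "x * ?V \<in> lpa_free" and Vy: "?V * y \<in> lpa_free"
    using x y V by (simp_all add: free_algebra_mult)
  define p q where "p = normal_form (x * ?V)" and "q = normal_form (?V * y)"
  have p_span: "p \<in> normal_span"
    using act_normal_span [OF one_normal_span xV] by (simp add: p_def normal_form_def)
  have p_eq: "p = ract (Vertex v) (normal_form x)"
    by (simp add: p_def normal_form_mult)
  have p: "normal (letters z) \<and> letters z \<noteq> [] \<and> tgt (last (letters z)) = v" if "z \<in> Poly_Mapping.keys p" for z
    using keys_normal_form [OF xV] keys_ract_normal [of "normal_form x" "Vertex v" z] that v
      act_normal_span [OF one_normal_span x] p_eq by (auto simp: p_def normal_form_def)
  have q_eq: "q = act y (monomial [Vertex v])"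
    by (simp add: q_def normal_form_mult normal_form_gen)
  have q: "normal (letters z) \<and> letters z \<noteq> [] \<and> src (hd (letters z)) = v" if z: "z \<in> Poly_Mapping.keys q" for z
  proof -
    obtain u where "u \<in> Poly_Mapping.keys y" "z \<in> Poly_Mapping.keys (fold ract (letters u) (monomial [Vertex v]) :: _ \<Rightarrow>\<^sub>0 'k)"
      using keys_linear_extension z q_eq unfolding act_def by fast
    then show ?thesis
      using keys_fold_ract [of "monomial [Vertex v] :: _ \<Rightarrow>\<^sub>0 'k" "{v}" 0 "letters u" z] v y
      by (auto simp: carrier_free_algebra_iff normal_def)
  qed
  have "p \<noteq> 0" "q \<noteq> 0"
    using neg xV Vy by (simp_all add: p_def q_def normal_form_eq_0_iff)
  then have "act q p \<noteq> 0"
    using act_neq_0 p q by blast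
  moreover have "act q p = act y (ract (Vertex v) p)"
    using act_normal_form [OF p_span Vy] by (simp add: q_def act_mult)
  moreover have "ract (Vertex v) p = p"
    by (rule ract_Vertex) (use p in auto)
  moreover have "act y p = act (x * ?V * y) 1"
    by (simp add: p_def normal_form_def act_mult)
  ultimately show False
    using act_ideal_generated [OF xy one_normal_span] by simp
qed

theorem nonsingular_leavitt_path_algebra:
  "nonsingular (leavitt_path_algebra TYPE('k::field) H sl rl)"
  unfolding leavitt_path_algebra_def
proof (rule nonsingular_presented_algebra [OF lpa_rels_subset, where U = "(\<lambda>v. gen (Vertex v)) ` hverts H"])
  show "u * u - u \<in> (lpa_ideal :: (_ \<Rightarrow>\<^sub>0 'k) set)" if u: "u \<in> (\<lambda>v. gen (Vertex v)) ` hverts H" for u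
  proof -
    obtain v where "v \<in> hverts H" "u = gen (Vertex v)"
      using u by blast
    then show ?thesis
      using ideal_generated.base [OF lpa_rels_vertex [of v v]] by simp
  qed
qed (auto simp: free_algebra_gen dest: Vertex_left_unit Vertex_right_unit lpa_local_domain)

end

theorem corollary42:
  fixes H :: "('v, 'e) hypergraph"
    and sl rl :: "'e \<Rightarrow> 'v list"
  assumes "is_hypergraph H"
    and "is_listing (hedges H) (hsrc H) sl"
    and "is_listing (hedges H) (hrng H) rl"
    and "\<And>h. h \<in> hedges H \<Longrightarrow> size (hsrc H h) \<ge> 2 \<and> size (hrng H h) \<ge> 2"
  shows "nonsingular (leavitt_path_algebra TYPE('k::field) H sl rl)"
proof -
  interpret listed_hypergraph H sl rl
    using assms by unfold_locales
  show ?thesis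
    by (rule nonsingular_leavitt_path_algebra)
qed

end
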